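(* Let $\mathbb{X}=\ell_p^2$ (over $\mathbb{R}$), where $p\in\mathbb{N}\setminus\{1,2\}$. Let $T\in\mathbb{L}(\mathbb{X},\mathbb{X})$ be an isometry. Then there exists $\epsilon_0>0$ such that for each $0<\epsilon<\epsilon_0$, $T$ is the only uniform $\epsilon$-BPB approximation of $T$. Moreover, we can choose $\epsilon_0=\min\{2^{\frac{p-1}{p}},\delta_1\}$, where $\delta_1=\delta\big(\frac{L}{2(16p-9)}\big)$ is an $\frac{L}{2(16p-9)}$-arc length constant, corresponding to $\|\cdot\|_p$, of the curve $C=\{(x,y)\in\mathbb{R}^2:|x|^p+|y|^p=1\}$, and $L$ is the length of the curve $C$ with respect to $\|\cdot\|_2$.
   Context: $\mathbb{N}=\{1,2,3,\dots\}$. $\mathbb{L}(\mathbb{X},\mathbb{X})$ is the space of bounded linear operators on $\mathbb{X}$ with the operator norm; $S_Z$ is the unit sphere of a normed space $Z$; for an operator $A$, $M_A=\{x\in S_{\mathbb{X}}:\|Ax\|=\|A\|\}$. For $T\in S_{\mathbb{L}(\mathbb{X},\mathbb{X})}$ and $\epsilon>0$, an operator $A\in S_{\mathbb{L}(\mathbb{X},\mathbb{X})}$ is a uniform $\epsilon$-BPB approximation of $T$ if $\|T-A\|<\epsilon$ and there exists $\delta(\epsilon)>0$ such that for each $x_0\in S_{\mathbb{X}}$ with $\|Tx_0\|>1-\delta(\epsilon)$ there exists $u_0\in M_A$ with $\|u_0-x_0\|<\epsilon$. Let $\|\cdot\|_p$ denote the usual $\ell_p$ norm on $\mathbb{R}^2$,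 and let $C$ be a closed rectifiable curve in $\mathbb{R}^2$. For $x,y\in C$, $s(x,y)$ denotes the Euclidean arc length of the shorter arc between $x$ and $y$ along $C$. Given $\epsilon>0$, a real number $\delta=\delta(\epsilon)>0$ is an $\epsilon$-arc length constant of $C$ corresponding to $\|\cdot\|_p$ if for any $x,y\in C$, $s(x,y)\geq\epsilon$ implies $\|x-y\|_p\geq\delta$. *)

theory Defs
  imports "HOL-Analysis.Analysis"
begin

section \<open>Operators on a space carrying an arbitrary norm\<close>

text \<open>
  The exponent \<open>p\<close> of \<open>\<ell>\<^sub>p\<^sup>2\<close> is a variable, so its norm cannot be the \<^const>\<open>norm\<close> of a type
  class instance. Hence the norm is an explicit parameter \<open>N\<close> of everything in this section;
  \<^const>\<open>norm\<close> and \<^const>\<open>dist\<close> on \<open>real^2\<close> remain Euclidean.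
\<close>

definition lp_norm :: "nat \<Rightarrow> real ^ 'n \<Rightarrow> real"
  where "lp_norm p x = root p (\<Sum>i\<in>UNIV. \<bar>x $ i\<bar> ^ p)"

definition unit_sphere :: "('a \<Rightarrow> real) \<Rightarrow> 'a set"
  where "unit_sphere N = {x. N x = 1}"

definition bounded_operator :: "('a::real_vector \<Rightarrow> real) \<Rightarrow> ('a \<Rightarrow> 'a) \<Rightarrow> bool"
  where "bounded_operator N A \<longleftrightarrow> linear A \<and> (\<exists>K. \<forall>x. N (A x) \<le> K * N x)"

definition operator_norm :: "('a \<Rightarrow> real) \<Rightarrow> ('a \<Rightarrow> 'a) \<Rightarrow> real"
  where "operator_norm N A = (SUP x\<in>unit_sphere N. N (A x))"

definition operator_sphere :: "('a::real_vector \<Rightarrow> real) \<Rightarrow> ('a \<Rightarrow> 'a) set"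
  where "operator_sphere N = {A. bounded_operator N A \<and> operator_norm N A = 1}"

definition norm_attainment_set :: "('a \<Rightarrow> real) \<Rightarrow> ('a \<Rightarrow> 'a) \<Rightarrow> 'a set"
  where "norm_attainment_set N A = {x \<in> unit_sphere N. N (A x) = operator_norm N A}"

definition linear_isometry :: "('a::real_vector \<Rightarrow> real) \<Rightarrow> ('a \<Rightarrow> 'a) \<Rightarrow> bool"
  where "linear_isometry N T \<longleftrightarrow> bounded_operator N T \<and> (\<forall>x y. N (T x - T y) = N (x - y))"

definition uniform_BPB_approximation ::
    "('a::real_vector \<Rightarrow> real) \<Rightarrow> real \<Rightarrow> ('a \<Rightarrow> 'a) \<Rightarrow> ('a \<Rightarrow> 'a) \<Rightarrow> bool"
  where "uniform_BPB_approximation N \<epsilon> T A \<longleftrightarrow>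
    T \<in> operator_sphere N \<and> A \<in> operator_sphere N \<and>
    operator_norm N (\<lambda>x. T x - A x) < \<epsilon> \<and>
    (\<exists>\<delta>>0. \<forall>x\<^sub>0\<in>unit_sphere N. N (T x\<^sub>0) > 1 - \<delta> \<longrightarrow>
      (\<exists>u\<^sub>0\<in>norm_attainment_set N A. N (u\<^sub>0 - x\<^sub>0) < \<epsilon>))"


section \<open>Arc length on closed curves\<close>

definition inscribed_lengths :: "(real \<Rightarrow> 'a::metric_space) \<Rightarrow> real set"
  where "inscribed_lengths g =
    {(\<Sum>i<n. dist (g (t i)) (g (t (Suc i)))) | (n::nat) t. mono_on {..n} t \<and> t ` {..n} \<subseteq> {0..1}}"

definition rectifiable_path :: "(real \<Rightarrow> 'a::metric_space) \<Rightarrow> bool"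
  where "rectifiable_path g \<longleftrightarrow> path g \<and> bdd_above (inscribed_lengths g)"

definition path_length :: "(real \<Rightarrow> 'a::metric_space) \<Rightarrow> real"
  where "path_length g = Sup (inscribed_lengths g)"

text \<open>
  A closed curve is given as a point set, which is assumed to be a rectifiable Jordan curve. All
  simple closed parametrizations of such a set have the same length, so the infimum below is over
  a one-element set of reals.
\<close>

definition closed_curve_length :: "'a::metric_space set \<Rightarrow> real"
  where "closed_curve_length C = Inf {path_length g | g.
    simple_path g \<and> rectifiable_path g \<and> pathfinish g = pathstart g \<and> path_image g = C}"

text \<open>
  For distinct points \<open>x\<close>, \<open>y\<close> of a Jordan curve there are, up to reparametrization, exactly two
  arcs from \<open>x\<close> to \<open>y\<close> inside the curve, so the infimum is the length of the shorter one. An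
  injective path cannot join a point to itself, whence the separate case.
\<close>

definition shorter_arc_length :: "'a::metric_space set \<Rightarrow> 'a \<Rightarrow> 'a \<Rightarrow> real"
  where "shorter_arc_length C x y = (if x = y then 0 else Inf {path_length g | g.
    arc g \<and> rectifiable_path g \<and> path_image g \<subseteq> C \<and> pathstart g = x \<and> pathfinish g = y})"

definition arc_length_constant ::
    "('a::real_normed_vector \<Rightarrow> real) \<Rightarrow> 'a set \<Rightarrow> real \<Rightarrow> real \<Rightarrow> bool"
  where "arc_length_constant N C \<epsilon> \<delta> \<longleftrightarrow>
    \<delta> > 0 \<and> (\<forall>x\<in>C. \<forall>y\<in>C. shorter_arc_length C x y \<ge> \<epsilon> \<longrightarrow> N (x - y) \<ge> \<delta>)"

end

theory Submission
  imports Defs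
begin

text \<open>
  A uniform approximation \<open>A\<close> attains its norm on an \<open>\<epsilon>\<close>-net of the unit sphere. Along the vectors
  \<open>(1, t)\<close> the condition \<open>\<parallel>A x\<parallel>\<^sub>p = \<parallel>x\<parallel>\<^sub>p\<close> is, on each of four intervals, a polynomial equation of degree
  at most \<open>p\<close>; since \<open>p \<ge> 3\<close>, the coefficients of \<open>1\<close>, \<open>t\<close>, \<open>t\<^sup>2\<close>, \<open>t\<^sup>p\<close> can only all vanish if the matrix of
  \<open>A\<close> is a signed permutation matrix. Otherwise \<open>A\<close> attains its norm in at most \<open>8 p + 2 < 16 p - 9\<close>
  points. Of \<open>16 p - 9\<close> points equally spaced along the sphere, one is then at arc distance at least
  \<open>L / (2 (16 p - 9))\<close> from all of them, so they do not form an \<open>\<epsilon>\<close>-net. Hence \<open>A\<close> and the isometry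
  \<open>T\<close> are both signed permutations, and two different ones have distance at least \<open>2\<^bsup>(p - 1) / p\<^esup>\<close>.
\<close>

section \<open>The \<open>\<ell>\<^sub>p\<close> norm\<close>

lemma lp_norm_nonneg: "0 \<le> lp_norm p x"
  unfolding lp_norm_def by (cases "p = 0") (auto intro!: real_root_ge_zero sum_nonneg)

lemma lp_norm_power:
  assumes "0 < p"
  shows "lp_norm p x ^ p = (\<Sum>i\<in>UNIV. \<bar>x $ i\<bar> ^ p)"
  unfolding lp_norm_def using assms by (simp add: real_root_pow_pos2 sum_nonneg)

lemma lp_norm_eq_1_iff:
  assumes "0 < p"
  shows "lp_norm p x = 1 \<longleftrightarrow> (\<Sum>i\<in>UNIV. \<bar>x $ i\<bar> ^ p) = 1"
  unfolding lp_norm_def using assms by simp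

lemma lp_norm_zero [simp]: "0 < p \<Longrightarrow> lp_norm p 0 = 0"
  unfolding lp_norm_def by (simp add: power_0_left)

lemma lp_norm_scaleR:
  assumes "0 < p"
  shows "lp_norm p (c *\<^sub>R x) = \<bar>c\<bar> * lp_norm p x"
  unfolding lp_norm_def using assms
  by (simp add: abs_mult power_mult_distrib sum_distrib_left [symmetric] real_root_mult
      real_root_power_cancel)

lemma component_le_lp_norm:
  assumes "0 < p"
  shows "\<bar>x $ i\<bar> \<le> lp_norm p x"
proof -
  have "\<bar>x $ i\<bar> ^ p \<le> lp_norm p x ^ p"
    unfolding lp_norm_power [OF assms] by (rule member_le_sum) auto
  then show ?thesis
    using assms lp_norm_nonneg power_mono_iff by (metis abs_ge_zero)
qed

lemma norm_le_lp_norm: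
  fixes x :: "real ^ 'n"
  assumes "0 < p"
  shows "norm x \<le> CARD('n) * lp_norm p x"
proof -
  have "norm x \<le> (\<Sum>i\<in>UNIV. \<bar>x $ i\<bar>)"
    by (rule norm_le_l1_cart)
  also have "\<dots> \<le> (\<Sum>i\<in>(UNIV :: 'n set). lp_norm p x)"
    by (intro sum_mono component_le_lp_norm assms)
  finally show ?thesis by simp
qed

lemma lp_norm_le_norm:
  fixes x :: "real ^ 'n"
  assumes "0 < p"
  shows "lp_norm p x \<le> CARD('n) * norm x"
proof -
  have "lp_norm p x ^ p \<le> (\<Sum>i\<in>(UNIV :: 'n set). norm x ^ p)"
    unfolding lp_norm_power [OF assms] by (intro sum_mono power_mono component_le_norm_cart) auto
  also have "\<dots> = CARD('n) * norm x ^ p"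
    by simp
  also have "\<dots> \<le> CARD('n) ^ p * norm x ^ p"
    using assms by (intro mult_right_mono) (auto intro!: self_le_power)
  finally have "lp_norm p x ^ p \<le> (CARD('n) * norm x) ^ p"
    by (simp add: power_mult_distrib)
  then show ?thesis
    using assms lp_norm_nonneg power_mono_iff by (metis mult_nonneg_nonneg norm_ge_zero of_nat_0_le_iff)
qed

lemma lp_norm_eq_0_iff:
  assumes "0 < p"
  shows "lp_norm p x = 0 \<longleftrightarrow> x = 0"
  using norm_le_lp_norm [OF assms, of x] assms by auto

lemma convex_on_power_nonneg: "convex_on {0::real..} (\<lambda>x. x ^ n)"
  by (cases "even n") (auto intro: convex_power_odd convex_on_subset [OF convex_power_even])

text \<open>Minkowski's inequality by convexity: with a and b the norms of x and y, the vector (x +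
  y) / (a + b) is the average of x / a and y / b with weights \<open>u\<close> and
  \<open>1 - u\<close>, and t^p is convex on the nonnegative reals. Summing over the components
  bounds the p-th power of the norm of this average by 1.\<close>

lemma lp_norm_triangle:
  assumes p: "0 < p"
  shows "lp_norm p (x + y) \<le> lp_norm p x + lp_norm p y"
proof (cases "x = 0 \<or> y = 0")
  case True
  then show ?thesis using p lp_norm_nonneg by auto
next
  case False
  define a b where "a = lp_norm p x" and "b = lp_norm p y"
  have ab: "a > 0" "b > 0"
    unfolding a_def b_def using False lp_norm_nonneg lp_norm_eq_0_iff [OF p]
    by (metis less_eq_real_def)+
  define u where "u = a / (a + b)"
  have u: "0 \<le> u" "u \<le> 1" "1 - u = b / (a + b)"
    unfolding u_def using ab by (auto simp: field_simps)
  have pt: "\<bar>(x + y) $ i\<bar> ^ p / (a + b) ^ p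
      \<le> u * (\<bar>x $ i\<bar> ^ p / a ^ p) + (1 - u) * (\<bar>y $ i\<bar> ^ p / b ^ p)" for i
  proof -
    have "\<bar>(x + y) $ i\<bar> / (a + b) \<le> (\<bar>x $ i\<bar> + \<bar>y $ i\<bar>) / (a + b)"
      using ab by (intro divide_right_mono) auto
    also have "\<dots> = u * (\<bar>x $ i\<bar> / a) + (1 - u) * (\<bar>y $ i\<bar> / b)"
      unfolding u(3) unfolding u_def using ab by (simp add: add_divide_distrib)
    finally have "(\<bar>(x + y) $ i\<bar> / (a + b)) ^ p \<le> (u * (\<bar>x $ i\<bar> / a) + (1 - u) * (\<bar>y $ i\<bar> / b)) ^ p"
      using ab by (intro power_mono) auto
    also have "\<dots> \<le> u * (\<bar>x $ i\<bar> / a) ^ p + (1 - u) * (\<bar>y $ i\<bar> / b) ^ p"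
      using convex_onD [OF convex_on_power_nonneg, of "1 - u" "\<bar>x $ i\<bar> / a" "\<bar>y $ i\<bar> / b" p] u(1,2) ab
      by simp
    finally show ?thesis by (simp add: power_divide)
  qed
  have "lp_norm p (x + y) ^ p / (a + b) ^ p
      \<le> u * (lp_norm p x ^ p / a ^ p) + (1 - u) * (lp_norm p y ^ p / b ^ p)"
    unfolding lp_norm_power [OF p] sum_divide_distrib sum_distrib_left sum.distrib [symmetric]
    by (intro sum_mono pt)
  also have "\<dots> = 1"
    using ab unfolding a_def [symmetric] b_def [symmetric] by simp
  finally have "lp_norm p (x + y) ^ p \<le> (a + b) ^ p"
    using ab by (simp add: field_simps)
  then have "lp_norm p (x + y) \<le> a + b"
    using ab p lp_norm_nonneg power_mono_iff by (metis add_nonneg_nonneg less_imp_le)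
  then show ?thesis by (simp add: a_def b_def)
qed

lemma lp_norm_minus: "0 < p \<Longrightarrow> lp_norm p (- x) = lp_norm p x"
  using lp_norm_scaleR [of p "-1" x] by simp

lemma abs_lp_norm_diff_le:
  assumes "0 < p"
  shows "\<bar>lp_norm p x - lp_norm p y\<bar> \<le> lp_norm p (x - y)"
  using lp_norm_triangle [OF assms, of "x - y" y] lp_norm_triangle [OF assms, of "y - x" x]
    lp_norm_minus [OF assms, of "x - y"]
  by simp

section \<open>Norm attainment and signed permutations\<close>

text \<open>
  The matrix of a linear map is written with rows \<open>(a, b)\<close> and \<open>(c, d)\<close>.
\<close>

definition signed_permutation :: "real \<Rightarrow> real \<Rightarrow> real \<Rightarrow> real \<Rightarrow> bool"
  where "signed_permutation a b c d \<longleftrightarrow>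
    \<bar>a\<bar> = 1 \<and> b = 0 \<and> c = 0 \<and> \<bar>d\<bar> = 1 \<or> a = 0 \<and> \<bar>b\<bar> = 1 \<and> \<bar>c\<bar> = 1 \<and> d = 0"

text \<open>A singular 2x2 matrix has rank at most one, so it is the product of a column (k, l) and
  a row (e, f).\<close>

lemma singular_2x2E:
  fixes a b c d :: real
  assumes "a * d = b * c"
  obtains k l e f where "a = k * e" "b = k * f" "c = l * e" "d = l * f"
proof (cases "a = 0 \<and> b = 0")
  case True
  then show ?thesis using that [of 0 c d 1] by simp
next
  case False
  then have "a \<noteq> 0 \<or> b \<noteq> 0" by simp
  then show ?thesis
  proof
    assume "a \<noteq> 0"
    then show ?thesis using that [of 1 a b "c / a"] assms by (simp add: field_simps)
  next
    assume "b \<noteq> 0"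
    then show ?thesis using that [of 1 a b "d / b"] assms by (simp add: field_simps)
  qed
qed

text \<open>The four equations say that the coefficients of 1, t^p, t and t^2 vanish in 1 + s t^p -
  s1 (a + b t)^p - s2 (c + d t)^p. A singular matrix would give w e^p = 1 and w f^p = s but w
  e^(p-1) f = 0. For an invertible one, the last two equations are a homogeneous linear system
  forcing a zero in each row, and the first two give the remaining entries absolute value 1.\<close>

lemma signed_permutation_if_power_sums:
  fixes a b c d s s1 s2 :: real
  assumes p: "3 \<le> p" and s: "\<bar>s\<bar> = 1" "\<bar>s1\<bar> = 1" "\<bar>s2\<bar> = 1"
    and c0: "s1 * a ^ p + s2 * c ^ p = 1"
    and cp: "s1 * b ^ p + s2 * d ^ p = s"
    and c1: "s1 * a ^ (p - 1) * b + s2 * c ^ (p - 1) * d = 0"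
    and c2: "s1 * a ^ (p - 2) * b\<^sup>2 + s2 * c ^ (p - 2) * d\<^sup>2 = 0"
  shows "signed_permutation a b c d"
proof -
  define q where "q = p - 3"
  have q: "p = Suc (Suc (Suc q))"
    using p unfolding q_def by linarith
  have pos: "0 < p" using p by simp
  show ?thesis
  proof (cases "a * d = b * c")
    case True
    then obtain k l e f where ab: "a = k * e" "b = k * f" "c = l * e" "d = l * f"
      by (rule singular_2x2E)
    define w where "w = s1 * k ^ p + s2 * l ^ p"
    have "w * e ^ p = 1" "w * f ^ p = s"
      using c0 cp unfolding ab w_def by (simp_all add: algebra_simps power_mult_distrib)
    then have "w \<noteq> 0" "e \<noteq> 0" "f \<noteq> 0"
      using s(1) pos by (auto simp: power_0_left)
    moreover have "w * e ^ (p - 1) * f = 0"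
      using c1 unfolding ab w_def q by (simp add: algebra_simps power_mult_distrib)
    ultimately show ?thesis by simp
  next
    case False
    \<comment> \<open>\<open>Suc q\<close> is p - 2. Cramer's rule for the system in (u, v), whose
      determinant is a d - b c, gives u = v = 0; hence each row has a zero entry.\<close>
    define u v where "u = s1 * a ^ Suc q * b" and "v = s2 * c ^ Suc q * d"
    have uv: "u * a + v * c = 0" "u * b + v * d = 0"
      using c1 c2 unfolding u_def v_def q by (simp_all add: algebra_simps power2_eq_square)
    have "u * (a * d - b * c) = d * (u * a + v * c) - c * (u * b + v * d)"
      by (simp add: algebra_simps)
    moreover have "v * (a * d - b * c) = a * (u * b + v * d) - b * (u * a + v * c)"
      by (simp add: algebra_simps)
    ultimately have "u = 0" "v = 0"
      using False uv by auto
    then have z: "a = 0 \<or> b = 0" "c = 0 \<or> d = 0"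
      using s unfolding u_def v_def by auto
    have root1: "\<bar>z\<bar> = 1" if "s' * z ^ p = s''" "\<bar>s'\<bar> = 1" "\<bar>s''\<bar> = 1" for z s' s'' :: real
    proof -
      have "\<bar>z\<bar> ^ p = 1"
        using that by (metis abs_mult mult_1 power_abs)
      then show ?thesis
        using pos power_eq_imp_eq_base [of "\<bar>z\<bar>" p 1] by simp
    qed
    show ?thesis
    proof (cases "a = 0")
      case True
      then have "d = 0" using z False by auto
      then show ?thesis
        using True c0 cp s pos root1 [of s2 c 1] root1 [of s1 b s]
        by (auto simp: signed_permutation_def power_0_left)
    next
      case False
      then have "b = 0" using z by simp
      then have "c = 0" using z \<open>a * d \<noteq> b * c\<close> by auto
      then show ?thesis
        using \<open>b = 0\<close> c0 cp s pos root1 [of s1 a 1] root1 [of s2 d s]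
        by (auto simp: signed_permutation_def power_0_left)
    qed
  qed
qed

text \<open>By the binomial theorem the left-hand side is a polynomial of degree at most p with
  coefficients \<open>co k\<close>. As p >= 3, the indices 0, 1, 2, p are distinct, so the vanishing
  of these four coefficients is, up to binomial factors, the hypothesis of
  \<open>signed_permutation_if_power_sums\<close>. Hence some coefficient is nonzero.\<close>

lemma card_roots_signed_power_sum:
  fixes a b c d s s1 s2 :: real
  assumes p: "3 \<le> p" and s: "\<bar>s\<bar> = 1" "\<bar>s1\<bar> = 1" "\<bar>s2\<bar> = 1"
    and ns: "\<not> signed_permutation a b c d"
  defines "R \<equiv> {t. 1 + s * t ^ p - s1 * (a + b * t) ^ p - s2 * (c + d * t) ^ p = 0}"
  shows "finite R \<and> card R \<le> p"
proof -
  define co where "co k = (if k = 0 then 1 else 0) + (if k = p then s else 0)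
    - s1 * (of_nat (p choose k) * a ^ (p - k) * b ^ k)
    - s2 * (of_nat (p choose k) * c ^ (p - k) * d ^ k)" for k
  have bin: "(u + v * t) ^ p = (\<Sum>k\<le>p. of_nat (p choose k) * u ^ (p - k) * v ^ k * t ^ k)"
    for u v t :: real
    using binomial_ring [of "v * t" u p]
    by (simp add: power_mult_distrib mult_ac add.commute [of u])
  have eq: "1 + s * t ^ p - s1 * (a + b * t) ^ p - s2 * (c + d * t) ^ p = (\<Sum>k\<le>p. co k * t ^ k)" for t
  proof -
    have *: "(\<Sum>k\<le>p. (if k = 0 then 1 else 0) * t ^ k) = 1"
      "(\<Sum>k\<le>p. (if k = p then s else 0) * t ^ k) = s * t ^ p"
      by (simp_all add: if_distrib [of "\<lambda>x. x * _"] cong: if_cong)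
    show ?thesis
      unfolding co_def left_diff_distrib distrib_right sum.distrib sum_subtractf * bin
        sum_distrib_left by (simp add: mult_ac)
  qed
  have "\<exists>k\<le>p. co k \<noteq> 0"
  proof (rule ccontr)
    assume "\<not> ?thesis"
    then have co: "co k = 0" if "k \<le> p" for k using that by auto
    have ch: "real (p choose 1) \<noteq> 0" "real (p choose 2) \<noteq> 0"
      using p by simp_all
    have "signed_permutation a b c d"
    proof (rule signed_permutation_if_power_sums [OF p s])
      show "s1 * a ^ p + s2 * c ^ p = 1"
        using co [of 0] p by (simp add: co_def)
      show "s1 * b ^ p + s2 * d ^ p = s"
        using co [of p] p by (simp add: co_def)
      have "co 1 = - real (p choose 1) * (s1 * a ^ (p - 1) * b + s2 * c ^ (p - 1) * d)"
        using p by (simp add: co_def algebra_simps)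
      then show "s1 * a ^ (p - 1) * b + s2 * c ^ (p - 1) * d = 0"
        using co [of 1] p ch by simp
      have "co 2 = - real (p choose 2) * (s1 * a ^ (p - 2) * b\<^sup>2 + s2 * c ^ (p - 2) * d\<^sup>2)"
        using p by (simp add: co_def algebra_simps)
      then show "s1 * a ^ (p - 2) * b\<^sup>2 + s2 * c ^ (p - 2) * d\<^sup>2 = 0"
        using co [of 2] p ch by simp
    qed
    with ns show False ..
  qed
  then show ?thesis
    unfolding R_def eq by (rule polyfun_rootbound)
qed

text \<open>An affine function changes sign at most once, so on either side of its zero its absolute
  value is a constant sign times the function.\<close>

lemma abs_affine_power_on_halflines:
  fixes u v :: real
  shows "\<exists>q. \<forall>I. I \<subseteq> {..q} \<or> I \<subseteq> {q..} \<longrightarrow>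
    (\<exists>s. \<bar>s\<bar> = 1 \<and> (\<forall>t\<in>I. \<bar>u + v * t\<bar> ^ p = s * (u + v * t) ^ p))"
proof -
  have sgn: "\<exists>s::real. \<bar>s\<bar> = 1 \<and> (\<forall>t\<in>I. \<bar>u + v * t\<bar> ^ p = s * (u + v * t) ^ p)"
    if "(\<forall>t\<in>I. 0 \<le> u + v * t) \<or> (\<forall>t\<in>I. u + v * t \<le> 0)" for I
    using that
  proof
    assume "\<forall>t\<in>I. 0 \<le> u + v * t"
    then show ?thesis by (intro exI [of _ 1]) (simp add: abs_of_nonneg)
  next
    assume *: "\<forall>t\<in>I. u + v * t \<le> 0"
    have "\<bar>u + v * t\<bar> ^ p = (- 1) ^ p * (u + v * t) ^ p" if "t \<in> I" for t
    proof -
      have "\<bar>u + v * t\<bar> = - 1 * (u + v * t)" using * that by auto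
      then show ?thesis by (simp only: power_mult_distrib)
    qed
    then show ?thesis by (intro exI [of _ "(- 1) ^ p"]) (simp add: power_abs)
  qed
  \<comment> \<open>If v = 0, the quotient is 0 by default; the function is then constant and any
    break point serves.\<close>
  show ?thesis
  proof (rule exI [of _ "- u / v"], intro allI impI, rule sgn)
    fix I :: "real set" assume I: "I \<subseteq> {..- u / v} \<or> I \<subseteq> {- u / v..}"
    consider "v = 0" | "v > 0" | "v < 0" by linarith
    then show "(\<forall>t\<in>I. 0 \<le> u + v * t) \<or> (\<forall>t\<in>I. u + v * t \<le> 0)"
    proof cases
      case 1
      then show ?thesis by auto
    next
      case 2
      have "t \<le> - u / v \<Longrightarrow> u + v * t \<le> 0" "t \<ge> - u / v \<Longrightarrow> u + v * t \<ge> 0" for t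
        using 2 by (auto simp: field_simps)
      with I show ?thesis by (meson atLeast_iff atMost_iff subsetD)
    next
      case 3
      have "t \<le> - u / v \<Longrightarrow> u + v * t \<ge> 0" "t \<ge> - u / v \<Longrightarrow> u + v * t \<le> 0" for t
        using 3 by (auto simp: field_simps)
      with I show ?thesis by (meson atLeast_iff atMost_iff subsetD)
    qed
  qed
qed

lemma sort3:
  fixes x y z :: "'a::linorder"
  obtains q1 q2 q3 where "q1 \<le> q2" "q2 \<le> q3" "{x, y, z} = {q1, q2, q3}"
proof (cases rule: le_cases3 [of x y z])
  case 1 then show ?thesis using that [of x y z] by simp
next
  case 2 then show ?thesis using that [of y x z] by (simp add: insert_commute)
next
  case 3 then show ?thesis using that [of x z y] by (simp add: insert_commute)
next
  case 4 then show ?thesis using that [of z y x] by (simp add: insert_commute)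
next
  case 5 then show ?thesis using that [of y z x] by (simp add: insert_commute)
next
  case 6 then show ?thesis using that [of z x y] by (simp add: insert_commute)
qed

text \<open>The signs of t, a + b t and c + d t switch at one break point each. The three break
  points cut the line into four closed intervals, and on each of them the equation is polynomial
  with at most p roots.\<close>

lemma card_roots_power_sum:
  fixes a b c d :: real
  assumes p: "3 \<le> p" and ns: "\<not> signed_permutation a b c d"
  defines "R \<equiv> {t. 1 + \<bar>t\<bar> ^ p = \<bar>a + b * t\<bar> ^ p + \<bar>c + d * t\<bar> ^ p}"
  shows "finite R \<and> card R \<le> 4 * p"
proof -
  obtain x :: real where x: "\<And>I. I \<subseteq> {..x} \<or> I \<subseteq> {x..} \<Longrightarrow>
      \<exists>s. \<bar>s\<bar> = 1 \<and> (\<forall>t\<in>I. \<bar>0 + 1 * t\<bar> ^ p = s * (0 + 1 * t) ^ p)"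
    using abs_affine_power_on_halflines [of 0 1 p] by blast
  obtain y :: real where y: "\<And>I. I \<subseteq> {..y} \<or> I \<subseteq> {y..} \<Longrightarrow>
      \<exists>s. \<bar>s\<bar> = 1 \<and> (\<forall>t\<in>I. \<bar>a + b * t\<bar> ^ p = s * (a + b * t) ^ p)"
    using abs_affine_power_on_halflines [of a b p] by blast
  obtain z :: real where z: "\<And>I. I \<subseteq> {..z} \<or> I \<subseteq> {z..} \<Longrightarrow>
      \<exists>s. \<bar>s\<bar> = 1 \<and> (\<forall>t\<in>I. \<bar>c + d * t\<bar> ^ p = s * (c + d * t) ^ p)"
    using abs_affine_power_on_halflines [of c d p] by blast
  obtain q1 q2 q3 where q: "q1 \<le> q2" "q2 \<le> q3" "{x, y, z} = {q1, q2, q3}"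
    by (rule sort3)
  have piece: "finite (R \<inter> I) \<and> card (R \<inter> I) \<le> p"
    if I: "\<And>q. q \<in> {q1, q2, q3} \<Longrightarrow> I \<subseteq> {..q} \<or> I \<subseteq> {q..}" for I
  proof -
    have Ixyz: "I \<subseteq> {..x} \<or> I \<subseteq> {x..}" "I \<subseteq> {..y} \<or> I \<subseteq> {y..}" "I \<subseteq> {..z} \<or> I \<subseteq> {z..}"
      using I q(3) by blast+
    obtain s s1 s2 where s: "\<bar>s\<bar> = 1" "\<bar>s1\<bar> = 1" "\<bar>s2\<bar> = 1"
      and eq: "\<And>t. t \<in> I \<Longrightarrow> \<bar>t\<bar> ^ p = s * t ^ p"
        "\<And>t. t \<in> I \<Longrightarrow> \<bar>a + b * t\<bar> ^ p = s1 * (a + b * t) ^ p"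
        "\<And>t. t \<in> I \<Longrightarrow> \<bar>c + d * t\<bar> ^ p = s2 * (c + d * t) ^ p"
      using x [OF Ixyz(1)] y [OF Ixyz(2)] z [OF Ixyz(3)] by auto
    define R' where "R' = {t. 1 + s * t ^ p - s1 * (a + b * t) ^ p - s2 * (c + d * t) ^ p = 0}"
    have R': "finite R' \<and> card R' \<le> p"
      unfolding R'_def by (rule card_roots_signed_power_sum [OF p s ns])
    moreover have "R \<inter> I \<subseteq> R'"
      unfolding R_def R'_def using eq by auto
    ultimately show ?thesis
      by (meson card_mono finite_subset le_trans)
  qed
  define I1 I2 I3 I4 where "I1 = {..q1}" and "I2 = {q1..q2}" and "I3 = {q2..q3}" and "I4 = {q3..}"
  have pieces: "finite (R \<inter> I1) \<and> card (R \<inter> I1) \<le> p" "finite (R \<inter> I2) \<and> card (R \<inter> I2) \<le> p"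
    "finite (R \<inter> I3) \<and> card (R \<inter> I3) \<le> p" "finite (R \<inter> I4) \<and> card (R \<inter> I4) \<le> p"
    by (rule piece; use q(1,2) in \<open>auto simp: I1_def I2_def I3_def I4_def\<close>)+
  have R: "R = (R \<inter> I1) \<union> (R \<inter> I2) \<union> (R \<inter> I3) \<union> (R \<inter> I4)"
    by (auto simp: I1_def I2_def I3_def I4_def)
  have "card R \<le> card (R \<inter> I1) + card (R \<inter> I2) + card (R \<inter> I3) + card (R \<inter> I4)"
    by (subst R) (intro card_Un_le [THEN le_trans] add_mono le_refl)
  moreover have "finite R"
    by (subst R) (use pieces in blast)
  ultimately show ?thesis using pieces by linarith
qed

section \<open>Arc length on Lipschitz loops\<close>

text \<open>Length over an arbitrary parameter interval, so that subarcs of a loop are measured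
  without reparametrizing them to the unit interval.\<close>

definition length_on :: "(real \<Rightarrow> 'a::metric_space) \<Rightarrow> real \<Rightarrow> real \<Rightarrow> real"
  where "length_on g a b =
    Sup {(\<Sum>i<n. dist (g (t i)) (g (t (Suc i)))) | (n::nat) t. mono_on {..n} t \<and> t ` {..n} \<subseteq> {a..b}}"

lemma path_length_eq: "path_length g = length_on g 0 1"
  unfolding path_length_def length_on_def inscribed_lengths_def ..

lemma length_on_shift: "length_on (\<lambda>t. g (t + c)) a b = length_on g (a + c) (b + c)"
proof -
  have "{(\<Sum>i<n. dist (g (t i + c)) (g (t (Suc i) + c))) | (n::nat) t. mono_on {..n} t \<and> t ` {..n} \<subseteq> {a..b}}
      = {(\<Sum>i<n. dist (g (t i)) (g (t (Suc i)))) | (n::nat) t. mono_on {..n} t \<and> t ` {..n} \<subseteq> {a + c..b + c}}"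
    (is "?A = ?B")
  proof (intro equalityI subsetI)
    fix x assume "x \<in> ?A"
    then obtain n t where "x = (\<Sum>i<n. dist (g (t i + c)) (g (t (Suc i) + c)))"
      "mono_on {..n} t" "t ` {..n} \<subseteq> {a..b}"
      by blast
    then show "x \<in> ?B"
      by (intro CollectI exI [of _ n] exI [of _ "\<lambda>i. t i + c"])
        (auto simp: image_subset_iff intro!: mono_onI dest: mono_onD)
  next
    fix x assume "x \<in> ?B"
    then obtain n t where "x = (\<Sum>i<n. dist (g (t i)) (g (t (Suc i))))"
      "mono_on {..n} t" "t ` {..n} \<subseteq> {a + c..b + c}"
      by blast
    then show "x \<in> ?A"
      by (intro CollectI exI [of _ n] exI [of _ "\<lambda>i. t i - c"])
        (auto simp: image_subset_iff le_diff_eq diff_le_eq intro!: mono_onI dest: mono_onD)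
  qed
  then show ?thesis unfolding length_on_def by simp
qed

text \<open>Telescoping: the increments of \<open>W\<close> dominate the chords, which also makes
  \<open>W\<close> monotone on [a, b]. It will be linear for Lipschitz bounds, and a length function
  for additivity.\<close>

lemma inscribed_sum_le:
  fixes g :: "real \<Rightarrow> 'a::metric_space" and W :: "real \<Rightarrow> real"
  assumes step: "\<And>x y. a \<le> x \<Longrightarrow> x \<le> y \<Longrightarrow> y \<le> b \<Longrightarrow> dist (g x) (g y) \<le> W y - W x"
    and t: "mono_on {..n} t" "t ` {..n} \<subseteq> {a..b}"
  shows "(\<Sum>i<n. dist (g (t i)) (g (t (Suc i)))) \<le> W b - W a"
proof -
  have W: "W x \<le> W y" if "a \<le> x" "x \<le> y" "y \<le> b" for x y
    using step [OF that] zero_le_dist [of "g x" "g y"] by linarith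
  have "(\<Sum>i<n. dist (g (t i)) (g (t (Suc i)))) \<le> (\<Sum>i<n. W (t (Suc i)) - W (t i))"
    using t by (intro sum_mono step) (auto simp: image_subset_iff intro: mono_onD)
  also have "\<dots> = W (t n) - W (t 0)"
    by (rule sum_lessThan_telescope)
  also have "\<dots> \<le> W b - W a"
    using t by (intro diff_mono W) (auto simp: image_subset_iff)
  finally show ?thesis .
qed

lemma length_on_le:
  assumes "\<And>x y. a \<le> x \<Longrightarrow> x \<le> y \<Longrightarrow> y \<le> b \<Longrightarrow> dist (g x) (g y) \<le> W y - W x" and "a \<le> b"
  shows "length_on g a b \<le> W b - W a"
  unfolding length_on_def
proof (rule cSup_least)
  have "mono_on {..0::nat} (\<lambda>_. a) \<and> (\<lambda>_. a) ` {..0::nat} \<subseteq> {a..b}"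
    using assms(2) by (auto intro: mono_onI)
  then show "{(\<Sum>i<n. dist (g (t i)) (g (t (Suc i)))) | (n::nat) t.
      mono_on {..n} t \<and> t ` {..n} \<subseteq> {a..b}} \<noteq> {}"
    by blast
qed (use inscribed_sum_le [of a b g W] assms(1) in blast)

section \<open>Comparison of parametrizations and curve lengths\<close>

lemma inscribed_lengths_dist:
  assumes "s \<in> {0..1}" "t \<in> {0..1}"
  shows "dist (g s) (g t) \<in> inscribed_lengths g"
proof -
  have *: "dist (g x) (g y) \<in> inscribed_lengths g" if "0 \<le> x" "x \<le> y" "y \<le> 1" for x y
    unfolding inscribed_lengths_def
    by (intro CollectI exI [of _ 1] exI [of _ "\<lambda>i. if i = 0 then x else y"])
      (use that in \<open>auto intro: mono_onI\<close>)
  show ?thesis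
    using * [of s t] * [of t s] assms by (cases "s \<le> t") (auto simp: dist_commute)
qed

lemma dist_le_path_length:
  assumes "rectifiable_path g" "s \<in> {0..1}" "t \<in> {0..1}"
  shows "dist (g s) (g t) \<le> path_length g"
  unfolding path_length_def
  using assms by (intro cSup_upper inscribed_lengths_dist) (auto simp: rectifiable_path_def)

lemma path_length_nonneg: "rectifiable_path g \<Longrightarrow> 0 \<le> path_length g"
  using dist_le_path_length [of g 0 0] by simp

text \<open>Reversing the order of the points changes neither the chords nor their sum, since
  \<open>dist\<close> is symmetric. This serves transition maps that reverse orientation.\<close>

lemma antimono_sum_mem_inscribed_lengths:
  assumes t: "\<And>i j. i \<le> j \<Longrightarrow> j \<le> n \<Longrightarrow> t j \<le> t i" "t ` {..n} \<subseteq> {0..1::real}"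
  shows "(\<Sum>i<n. dist (g (t i)) (g (t (Suc i)))) \<in> inscribed_lengths g"
proof -
  define u where "u i = t (n - i)" for i
  have "(\<Sum>i<n. dist (g (t i)) (g (t (Suc i)))) = (\<Sum>i<n. dist (g (t (n - Suc i))) (g (t (Suc (n - Suc i)))))"
    by (rule sum.nat_diff_reindex [symmetric])
  also have "\<dots> = (\<Sum>i<n. dist (g (u i)) (g (u (Suc i))))"
    by (intro sum.cong) (auto simp: u_def dist_commute Suc_diff_Suc)
  finally have eq: "(\<Sum>i<n. dist (g (t i)) (g (t (Suc i)))) = (\<Sum>i<n. dist (g (u i)) (g (u (Suc i))))" .
  have "mono_on {..n} u" "u ` {..n} \<subseteq> {0..1}"
    using t by (auto simp: u_def image_subset_iff intro!: mono_onI)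
  then show ?thesis
    unfolding eq inscribed_lengths_def by blast
qed

text \<open>The injective transition map between two parametrizations is monotone or antimonotone.\<close>

lemma length_on_le_path_length_arc:
  fixes g h :: "real \<Rightarrow> 'a::metric_space"
  assumes h: "arc h" "rectifiable_path h"
    and g: "continuous_on {a..b} g" "inj_on g {a..b}" "a \<le> b"
    and sub: "g ` {a..b} \<subseteq> path_image h"
  shows "length_on g a b \<le> path_length h"
proof -
  obtain k where k: "homeomorphism {0..1} (path_image h) h k"
    by (rule homeomorphism_arc [OF h(1)])
  define f where "f = k \<circ> g"
  have gh: "g x \<in> path_image h" if "x \<in> {a..b}" for x
    using sub that by blast
  have hf: "h (f x) = g x" if "x \<in> {a..b}" for x
    using k gh [OF that] unfolding f_def homeomorphism_def by simp
  have f01: "f x \<in> {0..1}" if "x \<in> {a..b}" for x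
    using k gh [OF that] unfolding f_def homeomorphism_def by auto
  have "continuous_on {a..b} f"
    unfolding f_def using k g(1) sub
    by (intro continuous_on_compose) (auto simp: homeomorphism_def intro: continuous_on_subset)
  moreover have inj: "inj_on f {a..b}"
    using g(2) hf by (metis inj_onI inj_onD)
  ultimately have mono: "strict_mono_on {a..b} f \<or> strict_antimono_on {a..b} f"
    using injective_eq_monotone_map [of "{a..b}" f] is_interval_cc by blast
  show ?thesis
    unfolding length_on_def
  proof (rule cSup_least)
    have "mono_on {..0::nat} (\<lambda>_. a) \<and> (\<lambda>_. a) ` {..0::nat} \<subseteq> {a..b}"
      using g(3) by (auto intro: mono_onI)
    then show "{(\<Sum>i<n. dist (g (t i)) (g (t (Suc i)))) | (n::nat) t.
        mono_on {..n} t \<and> t ` {..n} \<subseteq> {a..b}} \<noteq> {}"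
      by blast
  next
    fix x assume "x \<in> {(\<Sum>i<n. dist (g (t i)) (g (t (Suc i)))) | (n::nat) t.
        mono_on {..n} t \<and> t ` {..n} \<subseteq> {a..b}}"
    then obtain n t where x: "x = (\<Sum>i<n. dist (g (t i)) (g (t (Suc i))))"
      and t: "mono_on {..n} t" "t ` {..n} \<subseteq> {a..b}"
      by blast
    have x': "x = (\<Sum>i<n. dist (h ((f \<circ> t) i)) (h ((f \<circ> t) (Suc i))))"
      unfolding x using t(2) hf by (intro sum.cong) (auto simp: image_subset_iff)
    have r: "(f \<circ> t) ` {..n} \<subseteq> {0..1}"
      using t(2) f01 by (auto simp: image_subset_iff)
    have tt: "t i \<in> {a..b}" "t j \<in> {a..b}" "t i \<le> t j" if "i \<le> j" "j \<le> n" for i j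
      using t that by (auto simp: image_subset_iff intro: mono_onD)
    from mono have "x \<in> inscribed_lengths h"
    proof
      assume f: "strict_mono_on {a..b} f"
      have "mono_on {..n} (f \<circ> t)"
        using tt f by (intro mono_onI) (auto simp: strict_mono_on_leD)
      then show ?thesis
        unfolding inscribed_lengths_def x' using r by blast
    next
      assume f: "strict_antimono_on {a..b} f"
      have "(f \<circ> t) j \<le> (f \<circ> t) i" if "i \<le> j" "j \<le> n" for i j
        using tt [OF that] monotone_onD [OF f, of "t i" "t j"] by (cases "t i = t j") auto
      then show ?thesis
        unfolding x' using r by (intro antimono_sum_mem_inscribed_lengths)
    qed
    then show "x \<le> path_length h"
      unfolding path_length_def using h(2) by (intro cSup_upper) (auto simp: rectifiable_path_def)
  qed
qed

lemma closed_curve_length_le: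
  assumes "simple_path g" "rectifiable_path g" "pathfinish g = pathstart g" "path_image g = C"
  shows "closed_curve_length C \<le> path_length g"
  unfolding closed_curve_length_def
  by (rule cInf_lower) (use assms path_length_nonneg in \<open>auto intro!: bdd_belowI [of _ 0]\<close>)

text \<open>Every parametrization of \<open>C\<close> passes through x and y, so its length is at
  least their distance; the infimum over the nonempty set of these lengths inherits the
  bound.\<close>

lemma closed_curve_length_pos:
  assumes g: "simple_path g" "rectifiable_path g" "pathfinish g = pathstart g" "path_image g = C"
    and xy: "x \<in> C" "y \<in> C" "x \<noteq> y"
  shows "0 < closed_curve_length C"
proof -
  have "dist x y \<le> closed_curve_length C"
    unfolding closed_curve_length_def
  proof (rule cInf_greatest)
    show "{path_length g |g. simple_path g \<and> rectifiable_path g \<and>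
        pathfinish g = pathstart g \<and> path_image g = C} \<noteq> {}"
      using g by blast
  next
    fix l assume "l \<in> {path_length g |g. simple_path g \<and> rectifiable_path g \<and>
        pathfinish g = pathstart g \<and> path_image g = C}"
    then obtain k where k: "l = path_length k" "rectifiable_path k" "path_image k = C"
      by blast
    then obtain s t where "s \<in> {0..1}" "t \<in> {0..1}" "x = k s" "y = k t"
      using xy unfolding path_image_def by blast
    then show "dist x y \<le> l"
      using dist_le_path_length k by blast
  qed
  then show ?thesis using xy(3) by (meson zero_less_dist_iff less_le_trans)
qed

lemma shorter_arc_length_le:
  assumes "arc g" "rectifiable_path g" "path_image g \<subseteq> C" "pathstart g = x" "pathfinish g = y" "x \<noteq> y"
  shows "shorter_arc_length C x y \<le> path_length g"
  unfolding shorter_arc_length_def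
  using assms path_length_nonneg by (auto intro!: cInf_lower bdd_belowI [of _ 0])

text \<open>Triangle inequality on a circle of circumference V, where the minimum of |s - t| and V -
  |s - t| is the circular distance: a point c closer than w to both a and b puts these at circular
  distance below 2 w.\<close>

lemma no_common_close_point:
  fixes a b c V w :: real
  assumes "min \<bar>a - c\<bar> (V - \<bar>a - c\<bar>) < w" "min \<bar>b - c\<bar> (V - \<bar>b - c\<bar>) < w"
    and "2 * w \<le> b - a" "b - a \<le> V - 2 * w"
    and "0 \<le> a \<and> a \<le> V" "0 \<le> b \<and> b \<le> V" "0 \<le> c \<and> c \<le> V"
  shows False
  using assms unfolding min_def abs_if by (auto split: if_splits)

text \<open>A loop is taken as a map of period 1 on the whole line, injective modulo integers, so
  that an arc crossing the base point is again the image of an interval. The Lipschitz bound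
  supplies continuity and rectifiability.\<close>

locale lipschitz_loop =
  fixes G :: "real \<Rightarrow> 'a::metric_space" and K :: real
  assumes periodic: "G (t + 1) = G t"
    and injective: "G s = G t \<Longrightarrow> \<exists>k::int. s = t + of_int k"
    and lipschitz: "dist (G s) (G t) \<le> K * \<bar>s - t\<bar>"
begin

lemma lipschitz_le: "x \<le> y \<Longrightarrow> dist (G x) (G y) \<le> K * y - K * x"
  using lipschitz [of x y] by (simp add: algebra_simps)

lemma periodic_nat: "G (t + of_nat n) = G t"
proof (induction n)
  case (Suc n)
  then show ?case using periodic [of "t + of_nat n"] by (simp add: algebra_simps)
qed simp

lemma periodic_int: "G (t + of_int k) = G t"
proof (cases k rule: int_cases2)
  case (nonneg n)
  then show ?thesis using periodic_nat by simp
next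
  case (nonpos n)
  then show ?thesis using periodic_nat [of "t - of_nat n" n] by simp
qed

lemma continuous_on_loop: "continuous_on S G"
proof (rule continuous_onI)
  fix x e :: real assume e: "e > 0"
  show "\<exists>d>0. \<forall>x'\<in>S. dist x' x < d \<longrightarrow> dist (G x') (G x) \<le> e"
  proof (intro exI [of _ "e / (\<bar>K\<bar> + 1)"] conjI ballI impI)
    show "0 < e / (\<bar>K\<bar> + 1)" using e by simp
    fix x' assume "dist x' x < e / (\<bar>K\<bar> + 1)"
    then have *: "\<bar>x' - x\<bar> * (\<bar>K\<bar> + 1) < e"
      by (simp add: dist_real_def field_simps)
    have "dist (G x') (G x) \<le> K * \<bar>x' - x\<bar>" by (rule lipschitz)
    also have "\<dots> \<le> \<bar>x' - x\<bar> * (\<bar>K\<bar> + 1)"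
      using mult_right_mono [of K "\<bar>K\<bar> + 1" "\<bar>x' - x\<bar>"] by (simp add: mult.commute)
    finally show "dist (G x') (G x) \<le> e" using * by simp
  qed
qed

lemma K_nonneg: "0 \<le> K"
  using order_trans [OF zero_le_dist lipschitz [of 0 1]] by simp

lemma loop_eqD:
  assumes "G s = G t" "\<bar>s - t\<bar> < 1"
  shows "s = t"
proof -
  obtain k :: int where k: "s = t + of_int k" using injective assms(1) by blast
  then have "\<bar>of_int k :: real\<bar> < 1" using assms(2) by simp
  then have "k = 0" by linarith
  then show "s = t" using k by simp
qed

lemma inj_on_loop: "inj_on G S" if "\<And>s t. s \<in> S \<Longrightarrow> t \<in> S \<Longrightarrow> \<bar>s - t\<bar> < 1"
  using that loop_eqD by (blast intro: inj_onI)

lemma range_loop: "range G = G ` {0..<1}"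
proof -
  have "G t \<in> G ` {0..<1}" for t
  proof (rule image_eqI)
    show "G t = G (frac t)"
      using periodic_int [of t "- \<lfloor>t\<rfloor>"] by (simp add: frac_def)
    show "frac t \<in> {0..<1}" by (simp add: frac_lt_1)
  qed
  then show ?thesis by auto
qed

lemma loop_basics:
  shows simple_path_loop: "simple_path G" and rectifiable_loop: "rectifiable_path G"
    and closed_loop: "pathfinish G = pathstart G" and path_image_loop: "path_image G = range G"
proof -
  show "simple_path G"
    unfolding simple_path_def loop_free_def path_def
  proof (intro conjI ballI impI continuous_on_loop)
    fix x y :: real assume xy: "x \<in> {0..1}" "y \<in> {0..1}" "G x = G y"
    then obtain k :: int where k: "x = y + of_int k" using injective by blast
    then have "k \<le> 1" "k \<ge> -1" using xy by auto
    then have "k = -1 \<or> k = 0 \<or> k = 1" by linarith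
    then show "x = y \<or> x = 0 \<and> y = 1 \<or> x = 1 \<and> y = 0"
      using k xy by auto
  qed
  have "x \<le> K" if x: "x \<in> inscribed_lengths G" for x
  proof -
    obtain n t where "x = (\<Sum>i<n. dist (G (t i)) (G (t (Suc i))))" "mono_on {..n} t" "t ` {..n} \<subseteq> {0..1}"
      using x unfolding inscribed_lengths_def by blast
    then show ?thesis using inscribed_sum_le [of 0 1 G "\<lambda>x. K * x" n t] lipschitz_le by simp
  qed
  then show "rectifiable_path G"
    unfolding rectifiable_path_def path_def by (intro conjI continuous_on_loop bdd_aboveI [of _ K])
  show "pathfinish G = pathstart G"
    using periodic [of 0] by (simp add: pathfinish_def pathstart_def)
  show "path_image G = range G"
    unfolding path_image_def
    using range_loop image_mono [of "{0..<1}" "{0..1}" G] image_mono [of "{0..1}" UNIV G] by force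
qed

section \<open>Length as an additive function of the parameter interval\<close>

lemma bdd_above_sums:
  "bdd_above {(\<Sum>i<n. dist (G (t i)) (G (t (Suc i)))) | (n::nat) t. mono_on {..n} t \<and> t ` {..n} \<subseteq> {a..b}}"
proof (rule bdd_aboveI)
  fix x assume "x \<in> {(\<Sum>i<n. dist (G (t i)) (G (t (Suc i)))) | (n::nat) t. mono_on {..n} t \<and> t ` {..n} \<subseteq> {a..b}}"
  then obtain n t where "x = (\<Sum>i<n. dist (G (t i)) (G (t (Suc i))))" "mono_on {..n} t" "t ` {..n} \<subseteq> {a..b}"
    by blast
  then show "x \<le> K * b - K * a"
    using inscribed_sum_le [of a b G "\<lambda>x. K * x" n t, OF lipschitz_le] by (simp only:)
qed

lemma length_on_lipschitz: "a \<le> b \<Longrightarrow> length_on G a b \<le> K * (b - a)"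
  using length_on_le [of a b G "\<lambda>x. K * x", OF lipschitz_le] by (simp only: right_diff_distrib)

lemma length_on_nonneg:
  assumes "a \<le> b"
  shows "0 \<le> length_on G a b"
proof -
  have "mono_on {..0::nat} (\<lambda>_. a)" "(\<lambda>_. a) ` {..0::nat} \<subseteq> {a..b}"
    using assms by (auto intro: mono_onI)
  then have "0 \<in> {(\<Sum>i<n. dist (G (t i)) (G (t (Suc i)))) | (n::nat) t. mono_on {..n} t \<and> t ` {..n} \<subseteq> {a..b}}"
    by (intro CollectI exI [of _ 0] exI [of _ "\<lambda>_. a"]) simp
  then show ?thesis unfolding length_on_def by (rule cSup_upper [OF _ bdd_above_sums])
qed

text \<open>Appending x and y to a subdivision of [a, x] gives one of [a, y] whose inscribed sum is
  larger by at least the chord from x to y.\<close>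

lemma length_on_step:
  assumes "a \<le> x" "x \<le> y"
  shows "dist (G x) (G y) \<le> length_on G a y - length_on G a x"
proof -
  have "length_on G a x \<le> length_on G a y - dist (G x) (G y)"
    unfolding length_on_def [of G a x]
  proof (rule cSup_least)
    have "mono_on {..0::nat} (\<lambda>_. a) \<and> (\<lambda>_. a) ` {..0::nat} \<subseteq> {a..x}"
      using assms by (auto intro: mono_onI)
    then show "{(\<Sum>i<n. dist (G (t i)) (G (t (Suc i)))) | (n::nat) t.
        mono_on {..n} t \<and> t ` {..n} \<subseteq> {a..x}} \<noteq> {}"
      by blast
  next
    fix l assume "l \<in> {(\<Sum>i<n. dist (G (t i)) (G (t (Suc i)))) | (n::nat) t.
        mono_on {..n} t \<and> t ` {..n} \<subseteq> {a..x}}"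
    then obtain n t where l: "l = (\<Sum>i<n. dist (G (t i)) (G (t (Suc i))))"
      and t: "mono_on {..n} t" "t ` {..n} \<subseteq> {a..x}"
      by blast
    define u where "u i = (if i \<le> n then t i else if i = Suc n then x else y)" for i
    have tn: "t i \<le> x" "a \<le> t i" if "i \<le> n" for i
      using t(2) that by (auto simp: image_subset_iff)
    have "mono_on {..Suc (Suc n)} u"
      using t(1) tn assms by (intro mono_onI) (auto simp: u_def dest: mono_onD intro: order_trans)
    moreover have "u ` {..Suc (Suc n)} \<subseteq> {a..y}"
      using tn assms by (force simp: u_def image_subset_iff)
    ultimately have "(\<Sum>i<Suc (Suc n). dist (G (u i)) (G (u (Suc i)))) \<le> length_on G a y"
      unfolding length_on_def by (intro cSup_upper bdd_above_sums) blast
    moreover have "(\<Sum>i<n. dist (G (u i)) (G (u (Suc i)))) = l"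
      unfolding l by (intro sum.cong) (auto simp: u_def)
    moreover have "u (Suc n) = x" "u (Suc (Suc n)) = y"
      by (simp_all add: u_def)
    ultimately show "l \<le> length_on G a y - dist (G x) (G y)"
      using zero_le_dist [of "G (u n)" "G x"] by (simp only: sum.lessThan_Suc)
  qed
  then show ?thesis by simp
qed

text \<open>One inequality uses the length from \<open>a\<close> as the dominating function in
  \<open>length_on_le\<close>, the other the glued function \<open>W\<close>; a chord across b is
  split at \<open>G b\<close> by the triangle inequality.\<close>

lemma length_on_add:
  assumes "a \<le> b" "b \<le> c"
  shows "length_on G a c = length_on G a b + length_on G b c"
proof (rule antisym)
  have "length_on G b c \<le> length_on G a c - length_on G a b"
    using assms by (intro length_on_le length_on_step) auto
  then show "length_on G a b + length_on G b c \<le> length_on G a c" by simp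
next
  define W where "W x = (if x \<le> b then length_on G a x else length_on G a b + length_on G b x)" for x
  have refl: "length_on G x x = 0" for x
    using length_on_lipschitz [of x x] length_on_nonneg [of x x] by simp
  have "length_on G a c \<le> W c - W a"
  proof (rule length_on_le)
    fix x y assume xy: "a \<le> x" "x \<le> y" "y \<le> c"
    consider "y \<le> b" | "b < x" | "x \<le> b" "b < y" by linarith
    then show "dist (G x) (G y) \<le> W y - W x"
    proof cases
      case 1
      then show ?thesis using length_on_step xy by (simp add: W_def)
    next
      case 2
      then show ?thesis using length_on_step [of b x y] xy by (simp add: W_def)
    next
      case 3
      then show ?thesis
        using length_on_step [of a x b] length_on_step [of b b y] xy refl [of b]
          dist_triangle [of "G x" "G y" "G b"]
        by (simp add: W_def)
    qed
  qed (use assms in simp)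
  also have "\<dots> = length_on G a b + length_on G b c"
    using assms refl by (auto simp: W_def)
  finally show "length_on G a c \<le> length_on G a b + length_on G b c" .
qed

lemma length_on_periodic: "length_on G (a + 1) (b + 1) = length_on G a b"
  using length_on_shift [of G 1 a b] periodic by simp

section \<open>The shorter of the two arcs between points of a loop\<close>

text \<open>
  Otherwise the image of \<open>h\<close> would miss one point on either side, and these two points
  separate \<open>G a\<close> from \<open>G b\<close> in the loop.
\<close>

lemma arc_contains_subarc:
  assumes h: "path h" "path_image h \<subseteq> range G"
    and ab: "a < b" "b < a + 1" "G a \<in> path_image h" "G b \<in> path_image h"
  shows "G ` {a..b} \<subseteq> path_image h \<or> G ` {b..a + 1} \<subseteq> path_image h"
proof (rule ccontr)
  assume "\<not> ?thesis"
  then obtain s t where s: "s \<in> {a..b}" "G s \<notin> path_image h"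
    and t: "t \<in> {b..a + 1}" "G t \<notin> path_image h"
    by blast
  have "s \<noteq> a" "s \<noteq> b" "t \<noteq> b" "t \<noteq> a + 1"
    using s t ab periodic by auto
  then have st: "a < s" "s < b" "b < t" "t < a + 1"
    using s t by auto
  \<comment> \<open>The missed points \<open>G s\<close> and \<open>G t\<close> cut the loop into
    two closed arcs that meet only there; \<open>A\<close> contains \<open>G b\<close>, and
    \<open>B\<close> contains \<open>G a\<close>, which is also \<open>G (a + 1)\<close>.\<close>
  define A B where "A = G ` {s..t}" and "B = G ` {t..s + 1}"
  have "closed A" "closed B"
    unfolding A_def B_def by (intro compact_imp_closed compact_continuous_image continuous_on_loop; simp)+
  have "range G \<subseteq> A \<union> B"
  proof
    fix x assume "x \<in> range G"
    then obtain r where r: "x = G r" by blast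
    define r' where "r' = s + frac (r - s)"
    have "G r' = x"
      unfolding r r'_def frac_def using periodic_int [of r "- \<lfloor>r - s\<rfloor>"] by (simp add: algebra_simps)
    moreover have "s \<le> r'" "r' < s + 1" by (simp_all add: r'_def frac_lt_1)
    ultimately show "x \<in> A \<union> B"
      unfolding A_def B_def by (cases "r' \<le> t") auto
  qed
  have "A \<inter> B \<subseteq> {G s, G t}"
  proof
    fix x assume "x \<in> A \<inter> B"
    then obtain u v where uv: "u \<in> {s..t}" "v \<in> {t..s + 1}" "x = G u" "G u = G v"
      unfolding A_def B_def by blast
    then obtain k :: int where k: "u = v + of_int k" using injective by blast
    then have "- 1 \<le> (of_int k :: real)" "(of_int k :: real) \<le> 0" using uv st by auto
    then have "k = - 1 \<or> k = 0" by linarith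
    \<comment> \<open>k = -1 forces u = s and v = s + 1, while k = 0 forces u = v = t.\<close>
    then have "u = s \<or> u = t" using k uv by auto
    then show "x \<in> {G s, G t}" using uv by auto
  qed
  have conn: "connected (path_image h)"
    by (rule connected_path_image [OF h(1)])
  have "G b \<in> A \<inter> path_image h" "G a \<in> B \<inter> path_image h"
    using ab st periodic [of a] unfolding A_def B_def by (auto intro!: image_eqI [of "G a" G "a + 1"])
  then have "A \<inter> path_image h \<noteq> {}" "B \<inter> path_image h \<noteq> {}"
    by blast+
  moreover have "A \<inter> B \<inter> path_image h = {}"
    using \<open>A \<inter> B \<subseteq> {G s, G t}\<close> s(2) t(2) by blast
  moreover have "path_image h \<subseteq> A \<union> B"
    using h(2) \<open>range G \<subseteq> A \<union> B\<close> by (rule subset_trans)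
  ultimately show False
    using conn \<open>closed A\<close> \<open>closed B\<close> unfolding connected_closed by blast
qed

text \<open>The witness runs affinely from parameter a to parameter b, in either direction; staying
  within less than one period makes it injective.\<close>

lemma subarc_of_loop:
  assumes "a \<noteq> b" "\<bar>a - b\<bar> < 1"
  obtains g where "arc g" "rectifiable_path g" "path_image g \<subseteq> range G"
    "pathstart g = G a" "pathfinish g = G b" "path_length g \<le> K * \<bar>a - b\<bar>"
proof
  define g where "g t = G (a + t * (b - a))" for t
  have lip: "dist (g x) (g y) \<le> (K * \<bar>a - b\<bar>) * y - (K * \<bar>a - b\<bar>) * x" if "x \<le> y" for x y
  proof -
    have "dist (g x) (g y) \<le> K * \<bar>(x - y) * (b - a)\<bar>"
      unfolding g_def using lipschitz [of "a + x * (b - a)" "a + y * (b - a)"]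
      by (simp add: algebra_simps)
    also have "\<bar>(x - y) * (b - a)\<bar> = (y - x) * \<bar>a - b\<bar>"
      using that by (simp add: abs_mult abs_minus_commute)
    also have "K * \<dots> = (K * \<bar>a - b\<bar>) * y - (K * \<bar>a - b\<bar>) * x"
      by (simp only: left_diff_distrib right_diff_distrib mult_ac)
    finally show ?thesis .
  qed
  have path: "path g"
    unfolding path_def g_def
    by (rule continuous_on_compose2 [OF continuous_on_loop [of UNIV]]) (auto intro!: continuous_intros)
  have "inj_on g {0..1}"
  proof (rule inj_onI)
    fix x y :: real assume xy: "x \<in> {0..1}" "y \<in> {0..1}" "g x = g y"
    then have "\<bar>x - y\<bar> * \<bar>b - a\<bar> \<le> 1 * \<bar>b - a\<bar>"
      by (intro mult_right_mono) auto
    also have "\<dots> < 1" using assms by simp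
    finally have "\<bar>(a + x * (b - a)) - (a + y * (b - a))\<bar> < 1"
      by (simp add: abs_mult flip: left_diff_distrib)
    then have "a + x * (b - a) = a + y * (b - a)"
      using xy(3) unfolding g_def by (intro loop_eqD)
    then show "x = y" using assms by simp
  qed
  then show "arc g" using path by (simp add: arc_def)
  have "l \<le> K * \<bar>a - b\<bar>" if l: "l \<in> inscribed_lengths g" for l
  proof -
    obtain n t where "l = (\<Sum>i<n. dist (g (t i)) (g (t (Suc i))))" "mono_on {..n} t" "t ` {..n} \<subseteq> {0..1}"
      using l unfolding inscribed_lengths_def by blast
    then show ?thesis
      using inscribed_sum_le [of 0 1 g "\<lambda>x. (K * \<bar>a - b\<bar>) * x" n t] lip by simp
  qed
  then show "rectifiable_path g"
    unfolding rectifiable_path_def using path by (intro conjI bdd_aboveI [of _ "K * \<bar>a - b\<bar>"])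
  show "path_image g \<subseteq> range G" "pathstart g = G a" "pathfinish g = G b"
    unfolding path_image_def pathstart_def pathfinish_def g_def by auto
  show "path_length g \<le> K * \<bar>a - b\<bar>"
    unfolding path_length_eq
    using length_on_le [of 0 1 g "\<lambda>x. (K * \<bar>a - b\<bar>) * x"] lip by simp
qed

lemma shorter_arc_length_loop_le:
  assumes "\<bar>a - b\<bar> < 1"
  shows "shorter_arc_length (range G) (G a) (G b) \<le> K * \<bar>a - b\<bar>"
proof (cases "a = b")
  case True
  then show ?thesis by (simp add: shorter_arc_length_def)
next
  case False
  obtain g where g: "arc g" "rectifiable_path g" "path_image g \<subseteq> range G"
    "pathstart g = G a" "pathfinish g = G b" "path_length g \<le> K * \<bar>a - b\<bar>"
    by (rule subarc_of_loop [OF False assms])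
  have "G a \<noteq> G b"
    using False assms loop_eqD by blast
  then show ?thesis
    using shorter_arc_length_le [OF g(1-5)] g(6) by simp
qed

text \<open>An arc in the loop joining the two points covers one of the two complementary subarcs
  and is at least as long as it. The unordered pair {x, y} covers both orders of the
  endpoints.\<close>

lemma shorter_arc_length_loop_ge:
  assumes ab: "a < b" "b < a + 1" and xy: "{x, y} = {G a, G b}"
  shows "min (length_on G a b) (length_on G b (a + 1)) \<le> shorter_arc_length (range G) x y"
proof -
  have ne: "G a \<noteq> G b"
    using ab loop_eqD [of a b] by auto
  then have "x \<noteq> y"
    using xy by (metis insert_absorb2 doubleton_eq_iff)
  from xy consider "x = G a" "y = G b" | "x = G b" "y = G a"
    by (auto simp: doubleton_eq_iff)
  then obtain u v where uv: "x = G u" "y = G v" "u \<noteq> v" "\<bar>u - v\<bar> < 1"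
    using that [of a b] that [of b a] ab by cases simp_all
  have "min (length_on G a b) (length_on G b (a + 1)) \<le> Inf {path_length g |g. arc g \<and>
      rectifiable_path g \<and> path_image g \<subseteq> range G \<and> pathstart g = x \<and> pathfinish g = y}"
  proof (rule cInf_greatest)
    show "{path_length g |g. arc g \<and> rectifiable_path g \<and> path_image g \<subseteq> range G \<and>
        pathstart g = x \<and> pathfinish g = y} \<noteq> {}"
      by (rule subarc_of_loop [OF uv(3,4)]) (use uv(1,2) in blast)
  next
    fix l assume "l \<in> {path_length g |g. arc g \<and> rectifiable_path g \<and> path_image g \<subseteq> range G \<and>
        pathstart g = x \<and> pathfinish g = y}"
    then obtain h where h: "l = path_length h" "arc h" "rectifiable_path h" "path_image h \<subseteq> range G"
      "pathstart h = x" "pathfinish h = y"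
      by blast
    have "{G a, G b} \<subseteq> path_image h"
      unfolding xy [symmetric] using h(5,6) pathstart_in_path_image pathfinish_in_path_image by blast
    then have "G ` {a..b} \<subseteq> path_image h \<or> G ` {b..a + 1} \<subseteq> path_image h"
      using arc_contains_subarc [of h a b] ab h(2,4) arc_imp_path by blast
    moreover have "length_on G a b \<le> l" if "G ` {a..b} \<subseteq> path_image h"
      unfolding h(1) using ab
      by (intro length_on_le_path_length_arc [OF h(2,3) continuous_on_loop _ _ that] inj_on_loop) auto
    moreover have "length_on G b (a + 1) \<le> l" if "G ` {b..a + 1} \<subseteq> path_image h"
      unfolding h(1) using ab
      by (intro length_on_le_path_length_arc [OF h(2,3) continuous_on_loop _ _ that] inj_on_loop) auto
    ultimately show "min (length_on G a b) (length_on G b (a + 1)) \<le> l"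
      by (meson min.coboundedI1 min.coboundedI2)
  qed
  then show ?thesis
    using \<open>x \<noteq> y\<close> unfolding shorter_arc_length_def by simp
qed

text \<open>Compactness: over parameter differences h in [r, 1 - r] the distance of
  \<open>G a\<close> and \<open>G (a + h)\<close> has a positive minimum d. Points closer than d
  thus have parameters within r modulo 1, and the Lipschitz bound makes one arc between them shorter
  than e. This is the source of arc length constants.\<close>

lemma shorter_arc_length_loop_small:
  assumes "0 < e"
  obtains d where "0 < d"
    "\<And>x y. x \<in> range G \<Longrightarrow> y \<in> range G \<Longrightarrow> dist x y < d \<Longrightarrow> shorter_arc_length (range G) x y < e"
proof -
  \<comment> \<open>The denominator K + 1 avoids division by zero and gives K * r < e; the cap 1 / 2
    keeps [r, 1 - r] nonempty.\<close>
  define r where "r = min (e / (K + 1)) (1 / 2)"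
  have r: "0 < r" "r \<le> 1 / 2" "K * r < e"
  proof -
    show "0 < r" "r \<le> 1 / 2" unfolding r_def using assms K_nonneg by (simp, intro min.cobounded2)
    then have "K * r < (K + 1) * r" by simp
    also have "\<dots> \<le> (K + 1) * (e / (K + 1))"
      using K_nonneg by (intro mult_left_mono) (auto simp: r_def)
    also have "\<dots> = e" using K_nonneg by simp
    finally show "K * r < e" .
  qed
  define S :: "(real \<times> real) set" where "S = {0..1} \<times> {r..1 - r}"
  have "compact S" unfolding S_def by (intro compact_Times) auto
  moreover have "(0, r) \<in> S" unfolding S_def using r by auto
  moreover have "continuous_on S (\<lambda>(a, h). dist (G a) (G (a + h)))"
    unfolding case_prod_unfold
    by (intro continuous_on_dist continuous_on_compose2 [OF continuous_on_loop [of UNIV]])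
      (auto intro!: continuous_intros)
  ultimately obtain z where z: "z \<in> S"
    "\<And>w. w \<in> S \<Longrightarrow> (case z of (a, h) \<Rightarrow> dist (G a) (G (a + h))) \<le> (case w of (a, h) \<Rightarrow> dist (G a) (G (a + h)))"
    using continuous_attains_inf [of S "\<lambda>(a, h). dist (G a) (G (a + h))"] by blast
  obtain a0 h0 where z0: "z = (a0, h0)" by fastforce
  define d where "d = dist (G a0) (G (a0 + h0))"
  have min: "d \<le> dist (G a) (G (a + h))" if "a \<in> {0..1}" "h \<in> {r..1 - r}" for a h
    using z(2) [of "(a, h)"] that unfolding z0 d_def S_def by simp
  have h0: "r \<le> h0" "h0 \<le> 1 - r"
    using z(1) unfolding z0 S_def by auto
  have "G a0 \<noteq> G (a0 + h0)"
    using h0 r loop_eqD [of a0 "a0 + h0"] by auto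
  then have "0 < d" by (simp add: d_def)
  moreover have "shorter_arc_length (range G) x y < e"
    if xy: "x \<in> range G" "y \<in> range G" "dist x y < d" for x y
  proof -
    obtain a where a: "a \<in> {0..<1}" "x = G a" using xy(1) range_loop by blast
    obtain b0 where b0: "y = G b0" using xy(2) by blast
    define h where "h = frac (b0 - a)"
    have y: "y = G (a + h)"
      unfolding b0 h_def frac_def using periodic_int [of b0 "- \<lfloor>b0 - a\<rfloor>"] by (simp add: algebra_simps)
    have h: "0 \<le> h" "h < 1" by (simp_all add: h_def frac_lt_1)
    have "h < r \<or> 1 - r < h"
      using min [of a h] a xy(3) y by fastforce
    then obtain b where b: "y = G b" "\<bar>a - b\<bar> < r"
    proof
      assume "h < r"
      then show ?thesis using that [of "a + h"] y h by simp
    next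
      \<comment> \<open>A difference close to 1 is a small one in the other direction, after one
        full turn.\<close>
      assume "1 - r < h"
      then show ?thesis
        using that [of "a + h - 1"] y h periodic [of "a + h - 1"] by simp
    qed
    have "shorter_arc_length (range G) x y \<le> K * \<bar>a - b\<bar>"
      unfolding a b using b(2) r by (intro shorter_arc_length_loop_le) simp
    also have "\<dots> \<le> K * r"
      using b(2) K_nonneg by (intro mult_left_mono) auto
    finally show ?thesis using r by simp
  qed
  ultimately show ?thesis by (rule that)
qed

text \<open>
  Among \<open>m\<close> equally spaced points of the loop, each point of \<open>M\<close> is closer than half the
  spacing to at most one.
\<close>

lemma point_far_from_finite_set:
  assumes M: "finite M" "card M < m" "M \<subseteq> range G"
  obtains x where "x \<in> range G"
    "\<And>u. u \<in> M \<Longrightarrow> closed_curve_length (range G) / (2 * m) \<le> shorter_arc_length (range G) u x"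
proof -
  \<comment> \<open>\<open>v\<close> is the arc length parameter and \<open>V\<close> the total
    length along \<open>G\<close>.\<close>
  define v where "v t = length_on G 0 t" for t
  define V where "V = v 1"
  have m: "0 < m" using M(2) by simp
  have vdiff: "length_on G a b = v b - v a" if "0 \<le> a" "a \<le> b" for a b
    using length_on_add [OF that] unfolding v_def by simp
  have vper: "length_on G b (a + 1) = V - (v b - v a)" if "0 \<le> a" "a \<le> b" "b \<le> 1" for a b
    using length_on_add [of b 1 "a + 1"] length_on_periodic [of 0 a] vdiff [of b 1] that
    unfolding V_def by (simp add: v_def)
  \<comment> \<open>\<open>G\<close> is one of the parametrizations in the infimum, so half the
    spacing along \<open>G\<close> is at least the claimed distance.\<close>
  have V: "closed_curve_length (range G) \<le> V"
    unfolding V_def v_def path_length_eq [symmetric]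
    using loop_basics by (intro closed_curve_length_le)
  \<comment> \<open>In the arc length parameter, the distance on a circle of circumference V bounds
    the shorter arc from below.\<close>
  have circ: "min \<bar>v b - v a\<bar> (V - \<bar>v b - v a\<bar>) \<le> shorter_arc_length (range G) (G a) (G b)"
    if ab: "a \<in> {0..<1}" "b \<in> {0..<1}" for a b
  proof -
    have mono: "v s \<le> v t" if "0 \<le> s" "s \<le> t" for s t
      using vdiff [OF that] length_on_nonneg [OF that(2)] by simp
    have lt: "min \<bar>v t - v s\<bar> (V - \<bar>v t - v s\<bar>) \<le> shorter_arc_length (range G) x y"
      if st: "0 \<le> s" "s < t" "t < 1" "{x, y} = {G s, G t}" for s t x y
      using shorter_arc_length_loop_ge [of s t x y] st vdiff [of s t] vper [of s t] mono [of s t] by simp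
    consider "a < b" | "b < a" | "a = b" by linarith
    then show ?thesis
    proof cases
      case 1
      then show ?thesis using lt [of a b "G a" "G b"] ab by simp
    next
      case 2
      then show ?thesis
        using lt [of b a "G a" "G b"] ab by (simp add: insert_commute abs_minus_commute)
    next
      case 3
      then show ?thesis by (simp add: shorter_arc_length_def)
    qed
  qed
  have V_pos: "0 < V"
  proof -
    have "G 0 \<noteq> G (1 / 2)" using loop_eqD [of 0 "1 / 2"] by auto
    moreover have "dist (G 0) (G (1 / 2)) \<le> V"
      unfolding V_def v_def path_length_eq [symmetric]
      by (rule dist_le_path_length [OF rectifiable_loop]) auto
    ultimately show ?thesis by (meson less_le_trans zero_less_dist_iff)
  qed
  have cont: "continuous_on {0..1} v"
  proof (rule lipschitz_on_continuous_on)
    show "K-lipschitz_on {0..1} v"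
    proof (rule lipschitz_onI [OF _ K_nonneg])
      have le: "dist (v s) (v t) \<le> K * dist s t" if "0 \<le> s" "s \<le> t" for s t
        using vdiff [OF that] length_on_nonneg [OF that(2)] length_on_lipschitz [OF that(2)] that
        by (simp add: dist_real_def)
      fix s t :: real assume "s \<in> {0..1}" "t \<in> {0..1}"
      then show "dist (v s) (v t) \<le> K * dist s t"
        using le [of s t] le [of t s] by (cases "s \<le> t") (auto simp: dist_commute)
    qed
  qed
  have v0: "v 0 = 0"
    using length_on_lipschitz [of 0 0] length_on_nonneg [of 0 0] by (simp add: v_def)
  have vbounds: "0 \<le> v s \<and> v s \<le> V" if "s \<in> {0..<1}" for s
    using that vdiff [of 0 s] vdiff [of s 1] length_on_nonneg [of 0 s] length_on_nonneg [of s 1] v0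
    unfolding V_def by simp
  \<comment> \<open>The intermediate value theorem places m points at arc length parameters k V / m;
    k < m excludes t = 1, which would repeat the base point.\<close>
  have "\<exists>t\<in>{0..<1}. v t = k * V / m" if k: "k < m" for k
  proof -
    have "real k * V < m * V" using k V_pos by simp
    then have kV: "k * V / m < V" using m by (simp add: field_simps)
    moreover have "v 0 \<le> k * V / m" using V_pos v0 by simp
    ultimately obtain t where "0 \<le> t" "t \<le> 1" "v t = k * V / m"
      using IVT' [of v 0 "k * V / m" 1] cont V_def by auto
    moreover have "t \<noteq> 1" using kV calculation by (auto simp: V_def)
    ultimately show ?thesis by auto
  qed
  then obtain t where t: "\<And>k. k < m \<Longrightarrow> t k \<in> {0..<1} \<and> v (t k) = k * V / m"
    by metis
  show ?thesis
  proof (rule ccontr)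
    assume not: "\<not> thesis"
    have "\<exists>u\<in>M. shorter_arc_length (range G) u (G (t k)) < V / (2 * m)" for k
    proof (rule ccontr)
      assume "\<not> ?thesis"
      then have far: "V / (2 * m) \<le> shorter_arc_length (range G) u (G (t k))" if "u \<in> M" for u
        using that by force
      have "closed_curve_length (range G) / (2 * m) \<le> V / (2 * m)"
        using V m by (intro divide_right_mono) auto
      then show False
        using that [of "G (t k)"] far not by (meson order_trans rangeI)
    qed
    then obtain u where u: "\<And>k. u k \<in> M" "\<And>k. shorter_arc_length (range G) (u k) (G (t k)) < V / (2 * m)"
      by metis
    \<comment> \<open>Pigeonhole: \<open>M\<close> has fewer than m points, so one of them is close
      to two of the equally spaced points.\<close>
    have "\<not> inj_on u {..<m}"
      using card_inj_on_le [of u "{..<m}" M] M(1,2) u(1) by auto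
    then obtain i j where ij: "i < m" "j < m" "i < j" "u i = u j"
      unfolding inj_on_def by (metis lessThan_iff linorder_neqE_nat)
    obtain c where c: "c \<in> {0..<1}" "u i = G c"
      using u(1) [of i] M(3) range_loop by blast
    define w where "w = V / (2 * m)"
    have close: "min \<bar>v (t k) - v c\<bar> (V - \<bar>v (t k) - v c\<bar>) < w" if "u k = G c" "k < m" for k
      using circ [OF c(1), of "t k"] u(2) [of k] t [OF that(2)] unfolding w_def that(1) by linarith
    \<comment> \<open>The spacing is 2 w, and 1 <= j - i <= m - 1 keeps the two points at least 2 w
      apart both ways around the circle.\<close>
    have "v (t j) - v (t i) \<ge> 2 * w" "v (t j) - v (t i) \<le> V - 2 * w"
    proof -
      have w2: "V / m = 2 * w" "V = m * (2 * w)" using m by (simp_all add: w_def)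
      have "v (t j) - v (t i) = j * (V / m) - i * (V / m)"
        using t ij by simp
      also have "\<dots> = (real j - real i) * (2 * w)"
        by (simp only: w2(1) left_diff_distrib)
      finally have "v (t j) - v (t i) = (real j - real i) * (2 * w)" .
      moreover have "1 * (2 * w) \<le> (real j - real i) * (2 * w)" "(real j - real i) * (2 * w) \<le> (real m - 1) * (2 * w)"
        using ij V_pos m by (intro mult_right_mono; simp add: w_def)+
      moreover have "(real m - 1) * (2 * w) = V - 2 * w"
        using w2(2) by (simp only: left_diff_distrib mult_1)
      ultimately show "v (t j) - v (t i) \<ge> 2 * w" "v (t j) - v (t i) \<le> V - 2 * w"
        by linarith+
    qed
    then show False
      using no_common_close_point [OF close close, of i j] c(2) ij vbounds c(1) t by metis
  qed
qed

end

section \<open>The unit circle of \<open>\<ell>\<^sub>p\<^sup>2\<close>\<close>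

lemma lp_norm_2_eq_1_iff:
  fixes v :: "real ^ 2"
  assumes "0 < p"
  shows "lp_norm p v = 1 \<longleftrightarrow> \<bar>v $ 1\<bar> ^ p + \<bar>v $ 2\<bar> ^ p = 1"
  using lp_norm_eq_1_iff [OF assms, of v] by (simp add: sum_2)

lemma abs_cos_diff_le: "\<bar>cos x - cos y\<bar> \<le> \<bar>x - y\<bar>" for x y :: real
proof -
  have "\<bar>cos x - cos y\<bar> = 2 * (\<bar>sin ((x + y) / 2)\<bar> * \<bar>sin ((y - x) / 2)\<bar>)"
    unfolding cos_diff_cos by (simp add: abs_mult)
  also have "\<dots> \<le> 2 * (1 * \<bar>(y - x) / 2\<bar>)"
    by (intro mult_left_mono mult_mono abs_sin_x_le_abs_x) auto
  finally show ?thesis by simp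
qed

lemma abs_sin_diff_le: "\<bar>sin x - sin y\<bar> \<le> \<bar>x - y\<bar>" for x y :: real
  using abs_cos_diff_le [of "pi / 2 - x" "pi / 2 - y"] by (simp add: cos_sin_eq abs_minus_commute)

definition circle_point :: "real \<Rightarrow> real ^ 2"
  where "circle_point t = vector [cos (2 * pi * t), sin (2 * pi * t)]"

lemma norm_circle_point [simp]: "norm (circle_point t) = 1"
  by (simp add: circle_point_def norm_vec_def L2_set_def sum_2)

lemma circle_point_lipschitz: "norm (circle_point s - circle_point t) \<le> 4 * pi * \<bar>s - t\<bar>"
proof -
  have "norm (circle_point s - circle_point t)
      \<le> \<bar>cos (2 * pi * s) - cos (2 * pi * t)\<bar> + \<bar>sin (2 * pi * s) - sin (2 * pi * t)\<bar>"
    using norm_le_l1_cart [of "circle_point s - circle_point t"] by (simp add: sum_2 circle_point_def)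
  also have "\<dots> \<le> \<bar>2 * pi * s - 2 * pi * t\<bar> + \<bar>2 * pi * s - 2 * pi * t\<bar>"
    by (intro add_mono abs_cos_diff_le abs_sin_diff_le)
  also have "2 * pi * s - 2 * pi * t = 2 * pi * (s - t)"
    by (simp add: algebra_simps)
  finally show ?thesis by (simp add: abs_mult)
qed

lemma unit_vector_circle_pointE:
  fixes v :: "real ^ 2"
  assumes "norm v = 1"
  obtains t where "v = circle_point t"
proof -
  have "(v $ 1)\<^sup>2 + (v $ 2)\<^sup>2 = 1"
    using assms by (simp add: norm_vec_def L2_set_def sum_2)
  then obtain t where "v $ 1 = cos t" "v $ 2 = sin t"
    by (rule sincos_total_2pi)
  then have "v = circle_point (t / (2 * pi))"
    by (simp add: vec_eq_iff forall_2 circle_point_def)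
  then show ?thesis by (rule that)
qed

text \<open>Radial projection of the Euclidean circle. A parametrization by signed powers
  |cos|^(2/p), |sin|^(2/p) would not be Lipschitz for p > 2.\<close>

definition lp_circle_point :: "nat \<Rightarrow> real \<Rightarrow> real ^ 2"
  where "lp_circle_point p t = circle_point t /\<^sub>R lp_norm p (circle_point t)"

lemma lp_norm_circle_point_ge:
  assumes "0 < p"
  shows "1 / 2 \<le> lp_norm p (circle_point t)"
  using norm_le_lp_norm [OF assms, of "circle_point t"] by simp

text \<open>With r and q the norms of the circle points x and y, the difference x / r - y / q splits
  as (x - y) / r + (1 / r - 1 / q) y. As r and q are at least 1/2, the summands are at most 2 D and
  8 D, and D is at most 4 pi |s - t|.\<close>

lemma lp_circle_point_lipschitz:
  assumes p: "0 < p"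
  shows "dist (lp_circle_point p s) (lp_circle_point p t) \<le> 40 * pi * \<bar>s - t\<bar>"
proof -
  define x y where "x = circle_point s" and "y = circle_point t"
  define r q where "r = lp_norm p x" and "q = lp_norm p y"
  define D where "D = norm (x - y)"
  have rq: "1 / 2 \<le> r" "1 / 2 \<le> q"
    unfolding r_def q_def x_def y_def using lp_norm_circle_point_ge [OF p] by blast+
  have inv: "inverse r \<le> 2" "inverse q \<le> 2"
    using le_imp_inverse_le [OF rq(1)] le_imp_inverse_le [OF rq(2)] by simp_all
  have "\<bar>r - q\<bar> \<le> 2 * D"
    using abs_lp_norm_diff_le [OF p, of x y] lp_norm_le_norm [OF p, of "x - y"]
    unfolding r_def q_def D_def by simp
  moreover have "inverse r - inverse q = inverse r * inverse q * (q - r)"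
    using rq by (simp add: field_simps)
  ultimately have "\<bar>inverse r - inverse q\<bar> \<le> (2 * 2) * (2 * D)"
    using inv rq unfolding \<open>inverse r - _ = _\<close> abs_mult by (intro mult_mono) auto
  moreover have "norm (inverse r *\<^sub>R (x - y)) \<le> 2 * D"
  proof -
    have "norm (inverse r *\<^sub>R (x - y)) = inverse r * D"
      using rq by (simp add: D_def)
    also have "\<dots> \<le> 2 * D"
      using inv by (intro mult_right_mono) (simp_all add: D_def)
    finally show ?thesis .
  qed
  moreover have "norm ((inverse r - inverse q) *\<^sub>R y) = \<bar>inverse r - inverse q\<bar>"
    by (simp add: y_def)
  ultimately have "norm (inverse r *\<^sub>R (x - y) + (inverse r - inverse q) *\<^sub>R y) \<le> 10 * D"
    using norm_triangle_ineq [of "inverse r *\<^sub>R (x - y)" "(inverse r - inverse q) *\<^sub>R y"]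
    by linarith
  also have "inverse r *\<^sub>R (x - y) + (inverse r - inverse q) *\<^sub>R y
      = inverse r *\<^sub>R x - inverse q *\<^sub>R y"
    by (simp add: algebra_simps)
  also have "10 * D \<le> 10 * (4 * pi * \<bar>s - t\<bar>)"
    unfolding D_def x_def y_def by (intro mult_left_mono circle_point_lipschitz) simp
  finally show ?thesis
    unfolding dist_norm lp_circle_point_def x_def y_def r_def q_def by simp
qed

lemma lipschitz_loop_lp_circle_point:
  assumes p: "0 < p"
  shows "lipschitz_loop (lp_circle_point p) (40 * pi)"
proof
  show "lp_circle_point p (t + 1) = lp_circle_point p t" for t
    by (simp add: lp_circle_point_def circle_point_def distrib_left)
next
  fix s t assume eq: "lp_circle_point p s = lp_circle_point p t"
  define r q where "r = lp_norm p (circle_point s)" and "q = lp_norm p (circle_point t)"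
  have rq: "0 < r" "0 < q"
    unfolding r_def q_def using lp_norm_circle_point_ge [OF p, of s] lp_norm_circle_point_ge [OF p, of t] by auto
  have eq': "circle_point s /\<^sub>R r = circle_point t /\<^sub>R q"
    using eq by (simp add: lp_circle_point_def r_def q_def)
  \<comment> \<open>Both circle points have Euclidean norm 1, so the scaling factors agree and the
    angles can be compared.\<close>
  then have "norm (circle_point s /\<^sub>R r) = norm (circle_point t /\<^sub>R q)"
    by simp
  then have "r = q" using rq by simp
  then have "circle_point s = circle_point t" using eq' rq by simp
  then have "cos (2 * pi * s) = cos (2 * pi * t)" "sin (2 * pi * s) = sin (2 * pi * t)"
    by (simp_all add: circle_point_def vec_eq_iff forall_2)
  then obtain n :: int where "2 * pi * s = 2 * pi * t + 2 * pi * n"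
    using sin_cos_eq_iff by blast
  then have "(2 * pi) * s = (2 * pi) * (t + n)" by (simp only: distrib_left)
  then have "s = t + n" by simp
  then show "\<exists>k::int. s = t + of_int k" ..
qed (rule lp_circle_point_lipschitz [OF p])

lemma range_lp_circle_point:
  assumes p: "0 < p"
  shows "range (lp_circle_point p) = {v. lp_norm p v = 1}"
proof (intro equalityI subsetI)
  fix v assume "v \<in> range (lp_circle_point p)"
  then obtain t where "v = lp_circle_point p t" by blast
  then show "v \<in> {v. lp_norm p v = 1}"
    using lp_norm_circle_point_ge [OF p, of t] by (simp add: lp_circle_point_def lp_norm_scaleR [OF p])
next
  fix v :: "real ^ 2" assume "v \<in> {v. lp_norm p v = 1}"
  then have v: "lp_norm p v = 1" by simp
  then have n: "norm v \<noteq> 0" using lp_norm_eq_0_iff [OF p, of v] by auto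
  then have "norm (v /\<^sub>R norm v) = 1" by simp
  then obtain t where t: "v /\<^sub>R norm v = circle_point t"
    by (rule unit_vector_circle_pointE)
  have "v = lp_circle_point p t"
    unfolding lp_circle_point_def t [symmetric] using n v by (simp add: lp_norm_scaleR [OF p])
  then show "v \<in> range (lp_circle_point p)" by blast
qed

section \<open>Linear maps on the unit sphere of the plane\<close>

lemma linear_2_component:
  fixes A :: "real ^ 2 \<Rightarrow> real ^ 2"
  assumes "linear A"
  shows "A x $ i = A (axis 1 1) $ i * x $ 1 + A (axis 2 1) $ i * x $ 2"
proof -
  have "x = x $ 1 *\<^sub>R axis 1 1 + x $ 2 *\<^sub>R axis 2 1"
    by (simp add: vec_eq_iff forall_2 axis_def)
  then have "A x = A (x $ 1 *\<^sub>R axis 1 1 + x $ 2 *\<^sub>R axis 2 1)"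
    by (rule arg_cong)
  also have "\<dots> = x $ 1 *\<^sub>R A (axis 1 1) + x $ 2 *\<^sub>R A (axis 2 1)"
    by (simp add: linear_add [OF assms] linear_scale [OF assms])
  finally show ?thesis by simp
qed

abbreviation signed_permutation_map :: "(real ^ 2 \<Rightarrow> real ^ 2) \<Rightarrow> bool"
  where "signed_permutation_map A \<equiv> signed_permutation
    (A (axis 1 1) $ 1) (A (axis 2 1) $ 1) (A (axis 1 1) $ 2) (A (axis 2 1) $ 2)"

text \<open>Apart from (0, 1) and (0, -1), such a point is a multiple of (1, t) with t among the at
  most 4 p roots of \<open>card_roots_power_sum\<close>, and the line through (1, t) meets the
  sphere in two points. This makes 2 + 2 * 4 p.\<close>

lemma card_norm_preserved_points:
  fixes A :: "real ^ 2 \<Rightarrow> real ^ 2"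
  assumes p: "3 \<le> p" and A: "linear A" and ns: "\<not> signed_permutation_map A"
  defines "M \<equiv> {x. lp_norm p x = 1 \<and> lp_norm p (A x) = 1}"
  shows "finite M \<and> card M \<le> 8 * p + 2"
proof -
  have p0: "0 < p" using p by simp
  define a b c d where "a = A (axis 1 1) $ 1" and "b = A (axis 2 1) $ 1"
    and "c = A (axis 1 1) $ 2" and "d = A (axis 2 1) $ 2"
  define R where "R = {t. 1 + \<bar>t\<bar> ^ p = \<bar>a + b * t\<bar> ^ p + \<bar>c + d * t\<bar> ^ p}"
  have R: "finite R" "card R \<le> 4 * p"
    using card_roots_power_sum [OF p ns] unfolding R_def a_def b_def c_def d_def by auto
  \<comment> \<open>For s = 1 or s = -1, \<open>f (s, t)\<close> is the unit vector on the line
    through (1, t) whose first coordinate has sign s.\<close>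
  define f :: "real \<times> real \<Rightarrow> real ^ 2"
    where "f = (\<lambda>(s, t). (s / lp_norm p (vector [1, t] :: real ^ 2)) *\<^sub>R vector [1, t])"
  let ?S = "{vector [0, 1], vector [0, -1]} \<union> f ` ({1, -1} \<times> R)"
  have "M \<subseteq> ?S"
  proof
    fix x assume "x \<in> M"
    then have x: "lp_norm p x = 1" "\<bar>x $ 1\<bar> ^ p + \<bar>x $ 2\<bar> ^ p = 1"
      "\<bar>a * x $ 1 + b * x $ 2\<bar> ^ p + \<bar>c * x $ 1 + d * x $ 2\<bar> ^ p = 1"
      using p0 linear_2_component [OF A, of x]
      by (simp_all add: M_def lp_norm_2_eq_1_iff a_def b_def c_def d_def)
    show "x \<in> ?S"
    proof (cases "x $ 1 = 0")
      case True
      then have "\<bar>x $ 2\<bar> ^ p = 1" using x(2) p0 by (simp add: power_0_left)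
      then have "\<bar>x $ 2\<bar> = 1" using power_eq_imp_eq_base [of "\<bar>x $ 2\<bar>" p 1] p0 by simp
      then have "x $ 2 = 1 \<or> x $ 2 = -1" by linarith
      then show ?thesis using True by (auto simp: vec_eq_iff forall_2)
    next
      case False
      define t where "t = x $ 2 / x $ 1"
      have x2: "x $ 2 = t * x $ 1" using False by (simp add: t_def)
      have x1: "x = x $ 1 *\<^sub>R vector [1, t]"
        using x2 by (simp add: vec_eq_iff forall_2)
      have "\<bar>x $ 1\<bar> ^ p * (1 + \<bar>t\<bar> ^ p) = 1"
        using x(2) unfolding x2 by (simp add: abs_mult power_mult_distrib algebra_simps)
      moreover have "\<bar>x $ 1\<bar> ^ p * (\<bar>a + b * t\<bar> ^ p + \<bar>c + d * t\<bar> ^ p) = 1"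
      proof -
        have "a * x $ 1 + b * x $ 2 = x $ 1 * (a + b * t)" "c * x $ 1 + d * x $ 2 = x $ 1 * (c + d * t)"
          unfolding x2 by (simp_all add: algebra_simps)
        then have "\<bar>x $ 1 * (a + b * t)\<bar> ^ p + \<bar>x $ 1 * (c + d * t)\<bar> ^ p = 1"
          using x(3) by simp
        then show ?thesis
          unfolding abs_mult power_mult_distrib by (simp only: distrib_left [of "\<bar>x $ 1\<bar> ^ p"])
      qed
      ultimately have "\<bar>x $ 1\<bar> ^ p * (1 + \<bar>t\<bar> ^ p) = \<bar>x $ 1\<bar> ^ p * (\<bar>a + b * t\<bar> ^ p + \<bar>c + d * t\<bar> ^ p)"
        by (simp only:)
      then have "1 + \<bar>t\<bar> ^ p = \<bar>a + b * t\<bar> ^ p + \<bar>c + d * t\<bar> ^ p"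
        unfolding mult_cancel_left using False by (elim disjE) auto
      then have "t \<in> R" by (simp add: R_def)
      have "\<bar>x $ 1\<bar> * lp_norm p (vector [1, t] :: real ^ 2) = 1"
        using x(1) arg_cong [OF x1, of "lp_norm p"] by (simp only: lp_norm_scaleR [OF p0])
      then have "x $ 1 = sgn (x $ 1) / lp_norm p (vector [1, t] :: real ^ 2)"
        by (auto simp: sgn_if eq_divide_eq)
      then have "x = f (sgn (x $ 1), t)"
        unfolding f_def using x1 by simp
      moreover have "sgn (x $ 1) \<in> {1, -1}" using False by (auto simp: sgn_if)
      ultimately show ?thesis using \<open>t \<in> R\<close> by blast
    qed
  qed
  moreover have "finite ?S"
    using R(1) by blast
  moreover have "card ?S \<le> 2 + 2 * card R"
  proof -
    have "card ?S
        \<le> card {vector [0, 1], vector [0, -1] :: real ^ 2} + card (f ` ({1, -1} \<times> R))"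
      by (rule card_Un_le)
    also have "\<dots> \<le> 2 + card ({1, -1 :: real} \<times> R)"
      using R(1) by (intro add_mono card_image_le) (auto simp: card_insert_if)
    finally show ?thesis by (simp add: card_cartesian_product)
  qed
  ultimately show ?thesis
    using R card_mono [of ?S M] finite_subset [of M ?S] by fastforce
qed

text \<open>An isometry preserves the norm on the whole sphere, which is infinite, while a linear
  map that is no signed permutation does so at finitely many points of it only.\<close>

lemma signed_permutation_map_isometry:
  fixes T :: "real ^ 2 \<Rightarrow> real ^ 2"
  assumes p: "3 \<le> p" and T: "linear T" and iso: "\<And>x. lp_norm p (T x) = lp_norm p x"
  shows "signed_permutation_map T"
proof (rule ccontr)
  assume ns: "\<not> ?thesis"
  interpret lipschitz_loop "lp_circle_point p" "40 * pi"
    using p by (intro lipschitz_loop_lp_circle_point) simp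
  have "finite {x :: real ^ 2. lp_norm p x = 1}"
    using card_norm_preserved_points [OF p T ns] iso by simp
  then have "finite (range (lp_circle_point p))"
    using range_lp_circle_point [of p] p by simp
  then have "finite (lp_circle_point p ` {0<..<1})"
    by (rule finite_subset [rotated]) blast
  moreover have "inj_on (lp_circle_point p) {0<..<1}"
    by (rule inj_on_loop) auto
  ultimately have "finite {0<..<1::real}"
    by (rule finite_imageD)
  then show False by (simp add: infinite_Ioo)
qed

lemma lp_norm_axis: "0 < p \<Longrightarrow> lp_norm p (axis i 1 :: real ^ 2) = 1"
  using exhaust_2 [of i] by (auto simp: lp_norm_2_eq_1_iff axis_def power_0_left)

text \<open>Matrices of different shape, one diagonal and one antidiagonal, have first rows
  differing by 1 in both entries; those of the same shape are equal or some entry differs in sign,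
  hence by 2.\<close>

lemma signed_permutation_distinct:
  assumes s: "signed_permutation a b c d" "signed_permutation a' b' c' d'"
  shows "\<bar>a - a'\<bar> = 1 \<and> \<bar>b - b'\<bar> = 1 \<or> (a = a' \<and> b = b' \<and> c = c' \<and> d = d')
    \<or> \<bar>a - a'\<bar> = 2 \<or> \<bar>b - b'\<bar> = 2 \<or> \<bar>c - c'\<bar> = 2 \<or> \<bar>d - d'\<bar> = 2"
proof -
  have pm: "\<bar>x\<bar> = 1 \<longleftrightarrow> x = 1 \<or> x = - 1" for x :: real by linarith
  show ?thesis
    using s [unfolded signed_permutation_def pm] by (elim disjE conjE) simp_all
qed

text \<open>A sign change in an entry is seen at a basis vector, where the distance is at least 2
  and so no smaller than the bound. Different shapes are told apart at a vector with both
  coordinates of absolute value 2^(-1/p).\<close>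

lemma signed_permutation_maps_far:
  fixes A T :: "real ^ 2 \<Rightarrow> real ^ 2"
  assumes p: "1 \<le> p" and lin: "linear A" "linear T"
    and sp: "signed_permutation_map A" "signed_permutation_map T" and ne: "A \<noteq> T"
  shows "\<exists>x. lp_norm p x = 1 \<and> 2 powr ((real p - 1) / real p) \<le> lp_norm p (T x - A x)"
proof -
  have p0: "0 < p" using p by simp
  define k where "k = (2::real) powr ((real p - 1) / real p)"
  have k2: "k \<le> 2"
    unfolding k_def using p powr_mono [of "(real p - 1) / real p" 1 2] by simp
  have comp: "A x $ i = A (axis 1 1) $ i * x $ 1 + A (axis 2 1) $ i * x $ 2"
    "T x $ i = T (axis 1 1) $ i * x $ 1 + T (axis 2 1) $ i * x $ 2" for x i
    using linear_2_component lin by blast+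
  define a b where "a = T (axis 1 1) $ 1 - A (axis 1 1) $ 1" and "b = T (axis 2 1) $ 1 - A (axis 2 1) $ 1"
  have ex: "\<exists>i j. \<bar>T (axis j 1) $ i - A (axis j 1) $ i\<bar> = 2" if nab: "\<not> (\<bar>a\<bar> = 1 \<and> \<bar>b\<bar> = 1)"
  proof (rule ccontr)
    assume "\<not> ?thesis"
    then have no: "\<bar>T (axis j 1) $ i - A (axis j 1) $ i\<bar> \<noteq> 2" for i j by blast
    have eq: "T (axis 1 1) $ 1 = A (axis 1 1) $ 1" "T (axis 2 1) $ 1 = A (axis 2 1) $ 1"
      "T (axis 1 1) $ 2 = A (axis 1 1) $ 2" "T (axis 2 1) $ 2 = A (axis 2 1) $ 2"
      using signed_permutation_distinct [OF sp(2,1)] nab no unfolding a_def b_def by blast+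
    then have "A x = T x" for x
      by (simp add: vec_eq_iff forall_2 comp [of x])
    then show False using ne by blast
  qed
  have "\<exists>x. lp_norm p x = 1 \<and> k \<le> lp_norm p (T x - A x)"
  proof (cases "\<bar>a\<bar> = 1 \<and> \<bar>b\<bar> = 1")
    case True
    define h where "h = 2 powr (- 1 / real p)"
    \<comment> \<open>The signs a and b make both terms of the first component of T x - A x
      positive, so they add up to 2 h = 2^(1 - 1/p).\<close>
    define x :: "real ^ 2" where "x = vector [a * h, b * h]"
    have "0 < h" by (simp add: h_def)
    moreover have "h ^ p = 1 / 2"
    proof -
      have "h ^ p = h powr p" using \<open>0 < h\<close> by (simp only: powr_realpow)
      also have "\<dots> = 2 powr (- 1)" unfolding h_def powr_powr using p0 by simp
      finally show ?thesis by (simp add: powr_minus_divide)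
    qed
    ultimately have "lp_norm p x = 1"
      using True by (simp add: lp_norm_2_eq_1_iff [OF p0] x_def abs_mult)
    moreover have "k \<le> lp_norm p (T x - A x)"
    proof -
      have "(T x - A x) $ 1 = a * x $ 1 + b * x $ 2"
        unfolding a_def b_def by (simp add: comp [of x] algebra_simps)
      also have "\<dots> = (\<bar>a\<bar> * \<bar>a\<bar> + \<bar>b\<bar> * \<bar>b\<bar>) * h"
        by (simp add: x_def distrib_right)
      also have "\<dots> = 2 * h" using True by simp
      also have "\<dots> = k"
        unfolding h_def k_def using p0 by (simp add: diff_divide_distrib powr_diff powr_minus_divide)
      finally show ?thesis
        using component_le_lp_norm [OF p0, of "T x - A x" 1] by simp
    qed
    ultimately show ?thesis by blast
  next
    case False
    then obtain i j where "\<bar>T (axis j 1) $ i - A (axis j 1) $ i\<bar> = 2" using ex by blast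
    then have "k \<le> lp_norm p (T (axis j 1) - A (axis j 1))"
      using component_le_lp_norm [OF p0, of "T (axis j 1) - A (axis j 1)" i] k2 by simp
    then show ?thesis using lp_norm_axis [OF p0] by blast
  qed
  then show ?thesis by (simp add: k_def)
qed

section \<open>Operator norms\<close>

lemma le_operator_norm:
  fixes B :: "real ^ 'n \<Rightarrow> real ^ 'n"
  assumes p: "0 < p" and B: "linear B" and x: "lp_norm p x = 1"
  shows "lp_norm p (B x) \<le> operator_norm (lp_norm p) B"
proof -
  obtain c where c: "\<And>y. norm (B y) \<le> c * norm y"
    using linear_bounded [OF B] by blast
  \<comment> \<open>A supremum bounds its members only if the set is bounded above; the Euclidean
    bound on \<open>B\<close> transfers, with a factor \<open>CARD('n)\<close> from each comparison
    of norms.\<close>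
  have "lp_norm p (B y) \<le> CARD('n) * (\<bar>c\<bar> * CARD('n))" if "lp_norm p y = 1" for y
  proof -
    have "norm y \<le> CARD('n)" using norm_le_lp_norm [OF p, of y] that by simp
    then have "\<bar>c\<bar> * norm y \<le> \<bar>c\<bar> * CARD('n)" by (intro mult_left_mono) auto
    moreover have "c * norm y \<le> \<bar>c\<bar> * norm y" by (intro mult_right_mono) auto
    ultimately have "norm (B y) \<le> \<bar>c\<bar> * CARD('n)" using c [of y] by linarith
    then have "CARD('n) * norm (B y) \<le> CARD('n) * (\<bar>c\<bar> * CARD('n))" by (intro mult_left_mono) auto
    then show ?thesis using lp_norm_le_norm [OF p, of "B y"] by linarith
  qed
  then show ?thesis
    unfolding operator_norm_def unit_sphere_def using x
    by (intro cSUP_upper) (auto intro!: bdd_aboveI2)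
qed

lemma operator_norm_isometry:
  fixes T :: "real ^ 2 \<Rightarrow> real ^ 2"
  assumes p: "0 < p" and "\<And>x. lp_norm p (T x) = lp_norm p x"
  shows "operator_norm (lp_norm p) T = 1"
proof -
  have "(\<lambda>x. lp_norm p (T x)) ` unit_sphere (lp_norm p) = {1}"
    using assms(2) lp_norm_axis [OF p, of 1] by (auto simp: unit_sphere_def image_iff)
  then show ?thesis by (simp add: operator_norm_def)
qed

theorem theorem4p13:
  fixes p :: nat and T :: "real ^ 2 \<Rightarrow> real ^ 2" and C :: "(real ^ 2) set" and L :: real
  assumes p: "p \<ge> 1" "p \<notin> {1, 2}"
    and T: "linear_isometry (lp_norm p) T"
    and C: "C = {v. \<bar>v $ 1\<bar> ^ p + \<bar>v $ 2\<bar> ^ p = 1}"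
    and L: "L = closed_curve_length C"
  shows "(\<exists>\<epsilon>\<^sub>0>0. \<forall>\<epsilon>. 0 < \<epsilon> \<and> \<epsilon> < \<epsilon>\<^sub>0 \<longrightarrow>
           (\<forall>A. uniform_BPB_approximation (lp_norm p) \<epsilon> T A \<longleftrightarrow> A = T))
    \<and> (\<exists>\<delta>\<^sub>1. arc_length_constant (lp_norm p) C (L / (2 * (16 * real p - 9))) \<delta>\<^sub>1)
    \<and> (\<forall>\<delta>\<^sub>1 \<epsilon>\<^sub>0. arc_length_constant (lp_norm p) C (L / (2 * (16 * real p - 9))) \<delta>\<^sub>1 \<and>
           \<epsilon>\<^sub>0 = min (2 powr ((real p - 1) / real p)) \<delta>\<^sub>1 \<longrightarrow>
         \<epsilon>\<^sub>0 > 0 \<and>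
         (\<forall>\<epsilon>. 0 < \<epsilon> \<and> \<epsilon> < \<epsilon>\<^sub>0 \<longrightarrow>
           (\<forall>A. uniform_BPB_approximation (lp_norm p) \<epsilon> T A \<longleftrightarrow> A = T)))"
proof -
  define N :: "real ^ 2 \<Rightarrow> real" where "N = lp_norm p"
  define m where "m = 16 * p - 9"
  define \<eta> where "\<eta> = L / (2 * (16 * real p - 9))"
  have p3: "3 \<le> p" and p0: "0 < p"
    using p by auto
  \<comment> \<open>Since p >= 3, the subtraction on naturals is not truncated, and the count 8 p +
    2 of norm-preserved points stays below m.\<close>
  have m: "real m = 16 * real p - 9" "8 * p + 2 < m"
    using p3 by (auto simp: m_def)
  interpret lipschitz_loop "lp_circle_point p" "40 * pi"
    using p0 by (rule lipschitz_loop_lp_circle_point)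
  have sphere: "C = {v. N v = 1}" "range (lp_circle_point p) = C"
    unfolding C N_def range_lp_circle_point [OF p0] lp_norm_2_eq_1_iff [OF p0] by simp_all
  have linT: "linear T" and isoT: "N (T x) = N x" for x
  proof -
    show "linear T" using T by (simp add: linear_isometry_def bounded_operator_def)
    then show "N (T x) = N x"
      using T linear_0 unfolding linear_isometry_def N_def by (metis diff_zero)
  qed
  have normT: "operator_norm N T = 1"
    using operator_norm_isometry [OF p0] isoT unfolding N_def by blast
  have \<eta>: "\<eta> > 0"
  proof -
    have "axis 1 1 \<in> C" "axis 2 1 \<in> C" "axis 1 1 \<noteq> (axis 2 1 :: real ^ 2)"
      unfolding sphere N_def using lp_norm_axis [OF p0] by (auto simp: axis_eq_axis)
    then have "0 < L"
      unfolding L using loop_basics sphere(2) closed_curve_length_pos [of "lp_circle_point p"] by metis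
    then show ?thesis using p3 by (simp add: \<eta>_def)
  qed
  have ex_constant: "\<exists>\<delta>. arc_length_constant N C \<eta> \<delta>"
  proof -
    obtain d where d: "0 < d"
      "\<And>x y. x \<in> C \<Longrightarrow> y \<in> C \<Longrightarrow> dist x y < d \<Longrightarrow> shorter_arc_length C x y < \<eta>"
      using shorter_arc_length_loop_small [OF \<eta>] unfolding sphere by blast
    \<comment> \<open>The factor 1/2 appears because in the plane the Euclidean norm is at most
      twice the lp norm.\<close>
    have "d / 2 \<le> N (x - y)" if "x \<in> C" "y \<in> C" "\<eta> \<le> shorter_arc_length C x y" for x y
    proof -
      have "d \<le> norm (x - y)"
        using d(2) [OF that(1,2)] that(3) by (force simp: dist_norm)
      also have "\<dots> \<le> 2 * N (x - y)"
        using norm_le_lp_norm [OF p0, of "x - y"] by (simp add: N_def)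
      finally show ?thesis by simp
    qed
    then show ?thesis
      unfolding arc_length_constant_def using d(1) by (intro exI [of _ "d / 2"]) auto
  qed
  \<comment> \<open>The bound \<epsilon> < \<delta> forces \<open>A\<close> to be a signed
    permutation; the bound by 2^((p - 1) / p) then separates it from all signed permutations other
    than \<open>T\<close>.\<close>
  have unique: "uniform_BPB_approximation N \<epsilon> T A \<longleftrightarrow> A = T"
    if \<delta>: "arc_length_constant N C \<eta> \<delta>" and \<epsilon>: "0 < \<epsilon>" "\<epsilon> < 2 powr ((real p - 1) / real p)" "\<epsilon> < \<delta>"
    for \<delta> \<epsilon> A
  proof
    assume "A = T"
    have "bounded_operator N T"
      using T unfolding N_def by (simp add: linear_isometry_def)
    then have "T \<in> operator_sphere N" using normT by (simp add: operator_sphere_def)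
    moreover have "operator_norm N (\<lambda>x. T x - T x) = 0"
    proof -
      have "axis 1 1 \<in> unit_sphere N"
        unfolding unit_sphere_def N_def using lp_norm_axis [OF p0] by simp
      then have "unit_sphere N \<noteq> {}" by blast
      then show ?thesis
        unfolding operator_norm_def using lp_norm_zero [OF p0] by (simp add: N_def)
    qed
    moreover have "\<exists>u\<in>norm_attainment_set N T. N (u - x) < \<epsilon>" if "x \<in> unit_sphere N" for x
    proof (rule bexI [of _ x])
      show "N (x - x) < \<epsilon>" using \<epsilon>(1) p0 by (simp add: N_def)
      show "x \<in> norm_attainment_set N T"
        using that isoT normT by (simp add: norm_attainment_set_def unit_sphere_def)
    qed
    ultimately show "uniform_BPB_approximation N \<epsilon> T A"
      unfolding uniform_BPB_approximation_def \<open>A = T\<close> using \<epsilon>(1) by (auto intro!: exI [of _ 1])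
  next
    assume bpb: "uniform_BPB_approximation N \<epsilon> T A"
    have linA: "linear A" and normA: "operator_norm N A = 1"
      and close: "operator_norm N (\<lambda>x. T x - A x) < \<epsilon>"
      using bpb by (auto simp: uniform_BPB_approximation_def operator_sphere_def bounded_operator_def)
    \<comment> \<open>As \<open>T\<close> is an isometry, N (T x) = 1 exceeds 1 - d for every d > 0,
      so the condition applies to all unit vectors: the norm attainment set of \<open>A\<close> is
      an \<epsilon>-net of the sphere.\<close>
    have net: "\<exists>u. N u = 1 \<and> N (A u) = 1 \<and> N (u - x) < \<epsilon>" if x: "N x = 1" for x
    proof -
      obtain d where "d > 0" "\<forall>x\<in>unit_sphere N. N (T x) > 1 - d \<longrightarrow> (\<exists>u\<in>norm_attainment_set N A. N (u - x) < \<epsilon>)"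
        using bpb unfolding uniform_BPB_approximation_def by blast
      then have "\<exists>u\<in>norm_attainment_set N A. N (u - x) < \<epsilon>"
        using x isoT [of x] by (auto simp: unit_sphere_def)
      then show ?thesis using normA by (auto simp: norm_attainment_set_def unit_sphere_def)
    qed
    have spA: "signed_permutation_map A"
    proof (rule ccontr)
      assume ns: "\<not> ?thesis"
      define M where "M = {x. lp_norm p x = 1 \<and> lp_norm p (A x) = 1}"
      have "finite M" "card M \<le> 8 * p + 2"
        using card_norm_preserved_points [OF p3 linA ns] unfolding M_def by auto
      moreover have MC: "M \<subseteq> C" by (auto simp: M_def sphere N_def)
      \<comment> \<open>This x has arc distance at least \<eta> from all of \<open>M\<close>, hence
        lp distance at least \<delta>, which the net property excludes.\<close>
      ultimately obtain x where x: "x \<in> C"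
        "\<And>u. u \<in> M \<Longrightarrow> closed_curve_length C / (2 * m) \<le> shorter_arc_length C u x"
        using point_far_from_finite_set [of M m] m(2) unfolding sphere(2) by (metis le_less_trans)
      obtain u where u: "u \<in> M" "N (u - x) < \<epsilon>"
        using net [of x] x(1) by (auto simp: M_def sphere N_def)
      have "\<eta> \<le> shorter_arc_length C u x"
        using x(2) [OF u(1)] by (simp add: \<eta>_def L m)
      then have "\<delta> \<le> N (u - x)"
        using \<delta> u(1) MC x(1) by (auto simp: arc_length_constant_def)
      then show False using u(2) \<epsilon>(3) by simp
    qed
    have spT: "signed_permutation_map T"
      using signed_permutation_map_isometry [OF p3 linT] isoT by (simp add: N_def)
    show "A = T"
    proof (rule ccontr)
      assume "A \<noteq> T"
      then obtain x where x: "N x = 1" "2 powr ((real p - 1) / real p) \<le> N (T x - A x)"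
        using signed_permutation_maps_far [OF p(1) linA linT spA spT] unfolding N_def by blast
      have "N (T x - A x) \<le> operator_norm N (\<lambda>x. T x - A x)"
        using le_operator_norm [OF p0 linear_compose_sub [OF linT linA]] x(1) unfolding N_def by blast
      then show False using x(2) close \<epsilon>(2) by linarith
    qed
  qed
  have main: "min (2 powr ((real p - 1) / real p)) \<delta> > 0 \<and>
      (\<forall>\<epsilon>. 0 < \<epsilon> \<and> \<epsilon> < min (2 powr ((real p - 1) / real p)) \<delta> \<longrightarrow>
        (\<forall>A. uniform_BPB_approximation N \<epsilon> T A \<longleftrightarrow> A = T))"
    if "arc_length_constant N C \<eta> \<delta>" for \<delta>
    using unique [OF that] that by (auto simp: arc_length_constant_def)
  obtain \<delta> where "arc_length_constant N C \<eta> \<delta>" using ex_constant by blast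
  then show ?thesis
    using main unfolding N_def [symmetric] \<eta>_def [symmetric] by blast
qed

end
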